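(* Let $(M_c,\eta)$ be a cooriented contact manifold with symplectic cover $\pi:(M^s,\Omega=d\omega)\to M_c$ and Liouville vector field $\mathbb{L}$. Let $H\in C^\infty(M^s)$ be $1$-homogeneous, i.e. $\mathbb{L}(H)=H$, and let $Z_H$ be its Hamiltonian vector field, defined by $i_{Z_H}\Omega=dH$. Let $L\subset M^s$ be a Lagrangian submanifold of $(M^s,\Omega)$ which is also a Liouville submanifold. Then: (a) On each connected component of $M^s$, the functions $H$ and $-\omega(Z_H)$ differ by a constant. (b) $\omega|_L=0$. (c) $Z_H$ is tangent to $L$ if and only if, for each connected component of $M^s$, $H|_L$ is constant on the part of $L$ lying in that component.
   Context: A cooriented contact manifold $(M_c,\eta)$ is a $(2n+1)$-dimensional manifold with a global $1$-form $\eta$ such that around every point there are coordinates $(z,x_1,\dots,x_n,y_1,\dots,y_n)$ in which the contact structure is generated by $dz-\sum_i y_i\,dx_i$ (equivalently, $\eta$ is nowhere zero and $\ker\eta\cap\ker d\eta=\{0\}$). Symplectic cover: $M^s=\{(p,\beta_p): p\in M_c,\ \beta_p=s\,\eta_p \text{ for some } s\in\mathbb{R}\setminus\{0\}\}$, with projection $\pi(p,\beta_p)=p$. It carries the canonical $1$-form $\omega_{(p,\beta_p)}(X)=\beta_p(\pi_*X)$, and $\Omega=d\omega$ is a symplectic form on $M^s$. The Liouville vector field $\mathbb{L}$ on $M^s$ is the unique vector field with $i_{\mathbb{L}}\Omega=\omega$ (it generates fibrewise scaling: $\mathbb{L}=t\,\partial/\partial t$ where $\beta_p=t\,\eta_p$).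 A submanifold $L\subset M^s$ is a Liouville submanifold if it is invariant under the flow of $\mathbb{L}$. A submanifold is Lagrangian if each of its tangent spaces equals its own $\Omega$-orthogonal. *)

theory Defs
  imports "HOL-Analysis.Analysis"
begin

section \<open>Smooth maps between Euclidean spaces\<close>

text \<open>
  Class C^k on an open set, via iterated directional derivatives.
\<close>

primrec ck_on :: "nat \<Rightarrow> 'a::euclidean_space set \<Rightarrow> ('a \<Rightarrow> 'b::real_normed_vector) \<Rightarrow> bool" where
  "ck_on 0 S f \<longleftrightarrow> continuous_on S f"
| "ck_on (Suc k) S f \<longleftrightarrow>
     f differentiable_on S \<and> (\<forall>v. ck_on k S (\<lambda>x. frechet_derivative f (at x) v))"

definition smooth_on :: "'a::euclidean_space set \<Rightarrow> ('a \<Rightarrow> 'b::real_normed_vector) \<Rightarrow> bool" where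
  "smooth_on S f \<longleftrightarrow> (\<forall>k. ck_on k S f)"


section \<open>Smooth manifolds\<close>

text \<open>
  A chart is a pair of a domain and a coordinate map; the values of the coordinate map outside
  the domain are irrelevant. A manifold is given by an atlas. Its points are the elements of
  the chart domains, and its topology is the one generated by the sets that are open in some chart;
  for a smooth atlas this makes every chart a homeomorphism onto an open subset of the model space.
\<close>

type_synonym ('m, 'e) chart = "'m set \<times> ('m \<Rightarrow> 'e)"

definition chart_inv :: "('m, 'e) chart \<Rightarrow> 'e \<Rightarrow> 'm" where
  "chart_inv c = inv_into (fst c) (snd c)"

definition points :: "('m, 'e) chart set \<Rightarrow> 'm set" where
  "points A = (\<Union>c\<in>A. fst c)"

definition smooth_atlas :: "('m, 'e::euclidean_space) chart set \<Rightarrow> bool" where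
  "smooth_atlas A \<longleftrightarrow>
     (\<forall>c\<in>A. inj_on (snd c) (fst c) \<and> open (snd c ` fst c)) \<and>
     (\<forall>c\<in>A. \<forall>d\<in>A. open (snd c ` (fst c \<inter> fst d)) \<and>
        smooth_on (snd c ` (fst c \<inter> fst d)) (snd d \<circ> chart_inv c))"

definition manifold_topology :: "('m, 'e::euclidean_space) chart set \<Rightarrow> 'm topology" where
  "manifold_topology A =
     topology_generated_by {{p \<in> fst c. snd c p \<in> W} | c W. c \<in> A \<and> open W}"

definition smooth_manifold :: "('m, 'e::euclidean_space) chart set \<Rightarrow> bool" where
  "smooth_manifold A \<longleftrightarrow>
     smooth_atlas A \<and> Hausdorff_space (manifold_topology A) \<and>
     second_countable (manifold_topology A)"

definition smooth_function :: "('m, 'e::euclidean_space) chart set \<Rightarrow> ('m \<Rightarrow> real) \<Rightarrow> bool" where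
  "smooth_function A f \<longleftrightarrow> (\<forall>c\<in>A. smooth_on (snd c ` fst c) (f \<circ> chart_inv c))"

definition smooth_curve :: "('m, 'e::euclidean_space) chart set \<Rightarrow> real set \<Rightarrow> (real \<Rightarrow> 'm) \<Rightarrow> bool" where
  "smooth_curve A J \<gamma> \<longleftrightarrow>
     open J \<and> is_interval J \<and>
     continuous_map (top_of_set J) (manifold_topology A) \<gamma> \<and>
     (\<forall>c\<in>A. smooth_on {t \<in> J. \<gamma> t \<in> fst c} (snd c \<circ> \<gamma>))"


section \<open>Tangent vectors\<close>

text \<open>
  A tangent vector at p is the family of its coordinate vectors in the charts around p, related to
  one another by the derivatives of the coordinate changes; it is zero at every other index, so
  that equal tangent vectors are equal functions and the vector space operations are pointwise.
\<close>

type_synonym ('m, 'e) tangent = "('m, 'e) chart \<Rightarrow> 'e"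

definition tangent_space ::
    "('m, 'e::euclidean_space) chart set \<Rightarrow> 'm \<Rightarrow> ('m, 'e) tangent set" where
  "tangent_space A p =
     {v. (\<forall>c\<in>A. \<forall>d\<in>A. p \<in> fst c \<inter> fst d \<longrightarrow>
            v d = frechet_derivative (snd d \<circ> chart_inv c) (at (snd c p)) (v c)) \<and>
         (\<forall>c. \<not> (c \<in> A \<and> p \<in> fst c) \<longrightarrow> v c = 0)}"

text \<open>The tangent vector at p whose coordinate vector in the chart c is w:\<close>

definition tangent_of ::
    "('m, 'e::euclidean_space) chart set \<Rightarrow> 'm \<Rightarrow> ('m, 'e) chart \<Rightarrow> 'e \<Rightarrow> ('m, 'e) tangent" where
  "tangent_of A p c w =
     (\<lambda>d. if d \<in> A \<and> p \<in> fst d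
          then frechet_derivative (snd d \<circ> chart_inv c) (at (snd c p)) w else 0)"

definition velocity ::
    "('m, 'e::euclidean_space) chart set \<Rightarrow> (real \<Rightarrow> 'm) \<Rightarrow> real \<Rightarrow> ('m, 'e) tangent" where
  "velocity A \<gamma> t =
     (\<lambda>c. if c \<in> A \<and> \<gamma> t \<in> fst c then vector_derivative (snd c \<circ> \<gamma>) (at t) else 0)"

text \<open>
  Pointwise differentials are computed in an arbitrarily chosen chart around the point. By the
  chain rule (and, for the exterior derivative below, the symmetry of second derivatives), the
  values on tangent vectors do not depend on the choice.
\<close>

definition chart_at :: "('m, 'e) chart set \<Rightarrow> 'm \<Rightarrow> ('m, 'e) chart" where
  "chart_at A p = (SOME c. c \<in> A \<and> p \<in> fst c)"

definition differential ::
    "('m, 'e::euclidean_space) chart set \<Rightarrow> ('m \<Rightarrow> real) \<Rightarrow> 'm \<Rightarrow> ('m, 'e) tangent \<Rightarrow> real" where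
  "differential A f p v =
     (let c = chart_at A p in frechet_derivative (f \<circ> chart_inv c) (at (snd c p)) (v c))"

definition pushforward ::
    "('m, 'e::euclidean_space) chart set \<Rightarrow> ('n, 'f::euclidean_space) chart set \<Rightarrow>
     ('m \<Rightarrow> 'n) \<Rightarrow> 'm \<Rightarrow> ('m, 'e) tangent \<Rightarrow> ('n, 'f) tangent" where
  "pushforward A B f p v =
     (let c = chart_at A p; d = chart_at B (f p)
      in tangent_of B (f p) d
           (frechet_derivative (snd d \<circ> f \<circ> chart_inv c) (at (snd c p)) (v c)))"


section \<open>Vector fields, flows and submanifolds\<close>

definition vector_field ::
    "('m, 'e::euclidean_space) chart set \<Rightarrow> ('m \<Rightarrow> ('m, 'e) tangent) \<Rightarrow> bool" where
  "vector_field A X \<longleftrightarrow>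
     (\<forall>p\<in>points A. X p \<in> tangent_space A p) \<and>
     (\<forall>c\<in>A. smooth_on (snd c ` fst c) (\<lambda>x. X (chart_inv c x) c))"

definition integral_curve ::
    "('m, 'e::euclidean_space) chart set \<Rightarrow> ('m \<Rightarrow> ('m, 'e) tangent) \<Rightarrow> real set \<Rightarrow>
     (real \<Rightarrow> 'm) \<Rightarrow> bool" where
  "integral_curve A X J \<gamma> \<longleftrightarrow> smooth_curve A J \<gamma> \<and> (\<forall>t\<in>J. velocity A \<gamma> t = X (\<gamma> t))"

definition flow_invariant ::
    "('m, 'e::euclidean_space) chart set \<Rightarrow> ('m \<Rightarrow> ('m, 'e) tangent) \<Rightarrow> 'm set \<Rightarrow> bool" where
  "flow_invariant A X S \<longleftrightarrow>
     (\<forall>J \<gamma>. integral_curve A X J \<gamma> \<and> 0 \<in> J \<and> \<gamma> 0 \<in> S \<longrightarrow> \<gamma> ` J \<subseteq> S)"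

text \<open>
  Embedded submanifolds, by slice charts. The slice chart c need not belong to the
  given atlas, only to the maximal atlas containing it.
\<close>

definition submanifold :: "('m, 'e::euclidean_space) chart set \<Rightarrow> 'm set \<Rightarrow> bool" where
  "submanifold A S \<longleftrightarrow>
     S \<subseteq> points A \<and>
     (\<exists>k. \<forall>p\<in>S. \<exists>c W. smooth_atlas (insert c A) \<and> fst c \<subseteq> points A \<and> p \<in> fst c \<and>
        subspace W \<and> dim W = k \<and> snd c ` (fst c \<inter> S) = snd c ` fst c \<inter> W)"

text \<open>
  The tangent space of a submanifold, as a subspace of the tangent space of the ambient manifold,
  consists of the velocities of the curves running in the submanifold.
\<close>

definition submanifold_tangent ::
    "('m, 'e::euclidean_space) chart set \<Rightarrow> 'm set \<Rightarrow> 'm \<Rightarrow> ('m, 'e) tangent set" where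
  "submanifold_tangent A S p =
     {velocity A \<gamma> 0 | \<gamma> J. smooth_curve A J \<gamma> \<and> 0 \<in> J \<and> \<gamma> 0 = p \<and> \<gamma> ` J \<subseteq> S}"

definition tangent_to ::
    "('m, 'e::euclidean_space) chart set \<Rightarrow> ('m \<Rightarrow> ('m, 'e) tangent) \<Rightarrow> 'm set \<Rightarrow> bool" where
  "tangent_to A X S \<longleftrightarrow> (\<forall>p\<in>S. X p \<in> submanifold_tangent A S p)"


section \<open>Differential forms\<close>

text \<open>
  Forms are extended by zero to arguments that are not tangent vectors, so that
  covectors can be compared as functions.
\<close>

definition one_form ::
    "('m, 'e::euclidean_space) chart set \<Rightarrow> ('m \<Rightarrow> ('m, 'e) tangent \<Rightarrow> real) \<Rightarrow> bool" where
  "one_form A \<alpha> \<longleftrightarrow>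
     (\<forall>p\<in>points A.
        (\<forall>v\<in>tangent_space A p. \<forall>w\<in>tangent_space A p. \<forall>a b.
           \<alpha> p (\<lambda>c. a *\<^sub>R v c + b *\<^sub>R w c) = a * \<alpha> p v + b * \<alpha> p w) \<and>
        (\<forall>v. v \<notin> tangent_space A p \<longrightarrow> \<alpha> p v = 0)) \<and>
     (\<forall>c\<in>A. \<forall>w. smooth_on (snd c ` fst c)
        (\<lambda>x. \<alpha> (chart_inv c x) (tangent_of A (chart_inv c x) c w)))"

text \<open>
  In coordinates, the exterior derivative evaluated on v and w is the derivative of the function
  \<open>\<alpha>(w)\<close> in direction v minus that of \<open>\<alpha>(v)\<close> in direction w, where v and w are extended
  as vector fields with constant coordinates (whose Lie bracket vanishes).
\<close>

definition ext_deriv ::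
    "('m, 'e::euclidean_space) chart set \<Rightarrow> ('m \<Rightarrow> ('m, 'e) tangent \<Rightarrow> real) \<Rightarrow>
     'm \<Rightarrow> ('m, 'e) tangent \<Rightarrow> ('m, 'e) tangent \<Rightarrow> real" where
  "ext_deriv A \<alpha> p v w =
     (let c = chart_at A p;
          comp = (\<lambda>u x. \<alpha> (chart_inv c x) (tangent_of A (chart_inv c x) c u))
      in frechet_derivative (comp (w c)) (at (snd c p)) (v c) -
         frechet_derivative (comp (v c)) (at (snd c p)) (w c))"

definition lagrangian ::
    "('m, 'e::euclidean_space) chart set \<Rightarrow>
     ('m \<Rightarrow> ('m, 'e) tangent \<Rightarrow> ('m, 'e) tangent \<Rightarrow> real) \<Rightarrow> 'm set \<Rightarrow> bool" where
  "lagrangian A \<Omega> S \<longleftrightarrow>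
     submanifold A S \<and>
     (\<forall>p\<in>S. submanifold_tangent A S p =
        {v \<in> tangent_space A p. \<forall>w\<in>submanifold_tangent A S p. \<Omega> p v w = 0})"


section \<open>Contact manifolds and their symplectic covers\<close>

definition cooriented_contact ::
    "nat \<Rightarrow> ('m, 'e::euclidean_space) chart set \<Rightarrow> ('m \<Rightarrow> ('m, 'e) tangent \<Rightarrow> real) \<Rightarrow> bool" where
  "cooriented_contact n A \<eta> \<longleftrightarrow>
     smooth_manifold A \<and> DIM('e) = 2 * n + 1 \<and> one_form A \<eta> \<and>
     (\<forall>p\<in>points A.
        (\<exists>v\<in>tangent_space A p. \<eta> p v \<noteq> 0) \<and>
        {v \<in> tangent_space A p. \<eta> p v = 0} \<inter>
        {v \<in> tangent_space A p. \<forall>w\<in>tangent_space A p. ext_deriv A \<eta> p v w = 0} = {\<lambda>_. 0})"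

type_synonym ('m, 'e) covector = "('m, 'e) tangent \<Rightarrow> real"

definition symplectic_cover ::
    "('m, 'e::euclidean_space) chart set \<Rightarrow> ('m \<Rightarrow> ('m, 'e) covector) \<Rightarrow>
     ('m \<times> ('m, 'e) covector) set" where
  "symplectic_cover A \<eta> = {(p, \<beta>). p \<in> points A \<and> (\<exists>s. s \<noteq> 0 \<and> \<beta> = (\<lambda>v. s * \<eta> p v))}"

definition fibre_coord :: "('m \<Rightarrow> ('m, 'e) covector) \<Rightarrow> 'm \<times> ('m, 'e) covector \<Rightarrow> real" where
  "fibre_coord \<eta> q = (THE s. snd q = (\<lambda>v. s * \<eta> (fst q) v))"

text \<open>
  The symplectic cover is an open subset of the line subbundle of the cotangent bundle spanned by
  \<open>\<eta>\<close>. Its manifold structure is the induced one: the charts of the base together with the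
  fibre coordinate t given by \<open>\<beta> = t \<eta>\<close>.
\<close>

definition cover_atlas ::
    "('m, 'e::euclidean_space) chart set \<Rightarrow> ('m \<Rightarrow> ('m, 'e) covector) \<Rightarrow>
     ('m \<times> ('m, 'e) covector, 'e \<times> real) chart set" where
  "cover_atlas A \<eta> =
     (\<lambda>c. ({q \<in> symplectic_cover A \<eta>. fst q \<in> fst c}, \<lambda>q. (snd c (fst q), fibre_coord \<eta> q))) ` A"

text \<open>The projection to the base is \<open>fst\<close>, and the covector at a point q of the cover is \<open>snd q\<close>.\<close>

definition canonical_form ::
    "('m, 'e::euclidean_space) chart set \<Rightarrow> ('m \<Rightarrow> ('m, 'e) covector) \<Rightarrow>
     'm \<times> ('m, 'e) covector \<Rightarrow> ('m \<times> ('m, 'e) covector, 'e \<times> real) tangent \<Rightarrow> real" where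
  "canonical_form A \<eta> q X =
     (if X \<in> tangent_space (cover_atlas A \<eta>) q
      then snd q (pushforward (cover_atlas A \<eta>) A fst q X) else 0)"

definition cover_symplectic_form ::
    "('m, 'e::euclidean_space) chart set \<Rightarrow> ('m \<Rightarrow> ('m, 'e) covector) \<Rightarrow>
     'm \<times> ('m, 'e) covector \<Rightarrow> ('m \<times> ('m, 'e) covector, 'e \<times> real) tangent \<Rightarrow>
     ('m \<times> ('m, 'e) covector, 'e \<times> real) tangent \<Rightarrow> real" where
  "cover_symplectic_form A \<eta> = ext_deriv (cover_atlas A \<eta>) (canonical_form A \<eta>)"

definition liouville_field ::
    "('m, 'e::euclidean_space) chart set \<Rightarrow> ('m \<Rightarrow> ('m, 'e) covector) \<Rightarrow>
     ('m \<times> ('m, 'e) covector \<Rightarrow> ('m \<times> ('m, 'e) covector, 'e \<times> real) tangent) \<Rightarrow> bool" where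
  "liouville_field A \<eta> E \<longleftrightarrow>
     vector_field (cover_atlas A \<eta>) E \<and>
     (\<forall>q\<in>symplectic_cover A \<eta>. \<forall>X\<in>tangent_space (cover_atlas A \<eta>) q.
        cover_symplectic_form A \<eta> q (E q) X = canonical_form A \<eta> q X)"

definition hamiltonian_field ::
    "('m, 'e::euclidean_space) chart set \<Rightarrow> ('m \<Rightarrow> ('m, 'e) covector) \<Rightarrow>
     ('m \<times> ('m, 'e) covector \<Rightarrow> real) \<Rightarrow>
     ('m \<times> ('m, 'e) covector \<Rightarrow> ('m \<times> ('m, 'e) covector, 'e \<times> real) tangent) \<Rightarrow> bool" where
  "hamiltonian_field A \<eta> H Z \<longleftrightarrow>
     vector_field (cover_atlas A \<eta>) Z \<and>
     (\<forall>q\<in>symplectic_cover A \<eta>. \<forall>X\<in>tangent_space (cover_atlas A \<eta>) q.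
        cover_symplectic_form A \<eta> q (Z q) X = differential (cover_atlas A \<eta>) H q X)"

end

theory Submission
  imports Defs
begin

text \<open>
  Contracting \<open>i_E \<Omega> = \<omega>\<close> with \<open>Z\<close> gives \<open>\<omega>(Z) = - dH(E) = - H\<close>, so the constant in (a) is 0.
  In the coordinates \<open>(x, t)\<close> one has \<open>\<Omega> = dt \<and> \<eta> + t d\<eta>\<close>, which is nondegenerate because \<open>\<eta>\<close> is contact;
  hence \<open>E = t \<partial>/\<partial>t\<close>, its flow is the scaling by \<open>e^s\<close>, and invariance makes \<open>E\<close> tangent to \<open>L\<close>.
  Thus \<open>\<omega>(X) = \<Omega>(E, X) = 0\<close> on the Lagrangian \<open>L\<close>. If \<open>Z\<close> is tangent to \<open>L\<close>, then (a) and (b) give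
  \<open>H = - \<omega>(Z) = 0\<close> on \<open>L\<close>. Conversely, if \<open>H\<close> is constant along the curves in \<open>L\<close>, then
  \<open>\<Omega>(Z, X) = dH(X) = 0\<close> for all \<open>X\<close> tangent to \<open>L\<close>, so \<open>Z\<close> is tangent to the Lagrangian \<open>L\<close>.
\<close>

section \<open>Smooth maps and their second derivatives\<close>

text \<open>Functions that agree on an open set have the same derivatives at its points. As
  \<open>frechet_derivative\<close> is a choice governed by \<open>has_derivative\<close> alone, its
  values agree even before differentiability is known, which lets the induction pass to
  derivatives.\<close>

lemma ck_on_cong:
  assumes "open S" "\<And>x. x \<in> S \<Longrightarrow> f x = g x"
  shows "ck_on k S f \<longleftrightarrow> ck_on k S g"
  using assms(2)
proof (induction k arbitrary: f g)
  case 0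
  then show ?case using continuous_on_cong by force
next
  case (Suc k)
  have D: "(f has_derivative f') (at x) \<longleftrightarrow> (g has_derivative f') (at x)" if "x \<in> S" for x f'
    using has_derivative_transform_within_open[OF _ \<open>open S\<close> that, of f f' UNIV g]
      has_derivative_transform_within_open[OF _ \<open>open S\<close> that, of g f' UNIV f] Suc.prems
    by auto
  have "ck_on k S (\<lambda>x. frechet_derivative f (at x) v) \<longleftrightarrow>
        ck_on k S (\<lambda>x. frechet_derivative g (at x) v)" for v
    by (rule Suc.IH) (simp add: frechet_derivative_def D)
  then show ?case
    using D \<open>open S\<close> by (simp add: differentiable_on_eq_differentiable_at differentiable_def)
qed

lemma ck_on_mono:
  "ck_on k S f \<Longrightarrow> T \<subseteq> S \<Longrightarrow> ck_on k T f"
proof (induction k arbitrary: f)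
  case 0
  then show ?case using continuous_on_subset by auto
next
  case (Suc k)
  then show ?case using differentiable_on_subset by auto
qed

lemma smooth_on_cong:
  "open S \<Longrightarrow> (\<And>x. x \<in> S \<Longrightarrow> f x = g x) \<Longrightarrow> smooth_on S f \<longleftrightarrow> smooth_on S g"
  unfolding smooth_on_def using ck_on_cong by blast

lemma smooth_on_subset: "smooth_on S f \<Longrightarrow> T \<subseteq> S \<Longrightarrow> smooth_on T f"
  unfolding smooth_on_def using ck_on_mono by blast

lemma smooth_on_has_derivative:
  assumes "smooth_on S f" "open S" "x \<in> S"
  shows "(f has_derivative frechet_derivative f (at x)) (at x)"
proof -
  have "ck_on (Suc 0) S f" using assms(1) unfolding smooth_on_def by blast
  then show ?thesis
    using assms by (simp add: differentiable_on_eq_differentiable_at frechet_derivative_works)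
qed

lemma smooth_on_frechet_derivative:
  assumes "smooth_on S f"
  shows "smooth_on S (\<lambda>x. frechet_derivative f (at x) v)"
  unfolding smooth_on_def
proof
  fix k
  have "ck_on (Suc k) S f" using assms unfolding smooth_on_def by blast
  then show "ck_on k S (\<lambda>x. frechet_derivative f (at x) v)" by simp
qed

lemma smooth_on_imp_continuous_on: "smooth_on S f \<Longrightarrow> continuous_on S f"
  unfolding smooth_on_def by (metis ck_on.simps(1))

text \<open>Made for the transition maps of the cover, which are a base transition times the
  identity. The fibre part is a general affine map because differentiating in direction
  \<open>v\<close> turns it into the constant \<open>b * snd v\<close>; the class is thus closed
  under derivatives.\<close>

lemma smooth_on_map_prod_affine:
  fixes f :: "'a::euclidean_space \<Rightarrow> 'b::real_normed_vector"
  assumes "open U" "open V" "smooth_on U f"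
  shows "smooth_on (U \<times> V) (\<lambda>z. (f (fst z), b * snd z + c :: real))"
  unfolding smooth_on_def
proof
  fix k
  have "ck_on k U f" using assms unfolding smooth_on_def by blast
  then show "ck_on k (U \<times> V) (\<lambda>z. (f (fst z), b * snd z + c))"
  proof (induction k arbitrary: f b c)
    case 0
    then have "continuous_on (U \<times> V) (\<lambda>z. f (fst z))"
      by (auto intro!: continuous_on_compose2[of U f] continuous_intros)
    then show ?case
      by (simp add: continuous_on_Pair continuous_on_add continuous_on_mult continuous_on_snd)
  next
    case (Suc k)
    let ?F = "\<lambda>z. (f (fst z), b * snd z + c)"
    have op: "open (U \<times> V)" using assms by (simp add: open_Times)
    have D: "(?F has_derivative (\<lambda>v. (frechet_derivative f (at (fst z)) (fst v), b * snd v))) (at z)"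
      if "z \<in> U \<times> V" for z
    proof -
      have "(f has_derivative frechet_derivative f (at (fst z))) (at (fst z))"
        using Suc.prems that \<open>open U\<close>
        by (auto simp: differentiable_on_eq_differentiable_at frechet_derivative_works)
      then have "(f \<circ> fst has_derivative frechet_derivative f (at (fst z)) \<circ> fst) (at z)"
        by (intro diff_chain_at) (auto intro!: derivative_eq_intros)
      then show ?thesis
        by (auto intro!: derivative_eq_intros simp: o_def)
    qed
    have "ck_on k (U \<times> V) (\<lambda>z. frechet_derivative ?F (at z) v)" for v
    proof -
      have "ck_on k U (\<lambda>x. frechet_derivative f (at x) (fst v))"
        using Suc.prems by simp
      from Suc.IH[OF this, of 0 "b * snd v"]
      have "ck_on k (U \<times> V) (\<lambda>z. (frechet_derivative f (at (fst z)) (fst v), b * snd v))"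
        by simp
      moreover have "frechet_derivative ?F (at z) v =
          (frechet_derivative f (at (fst z)) (fst v), b * snd v)" if "z \<in> U \<times> V" for z
        using frechet_derivative_at[OF D[OF that]] by metis
      ultimately show ?thesis
        using ck_on_cong[OF op] by (metis (no_types, lifting))
    qed
    moreover have "?F differentiable_on (U \<times> V)"
      using D op by (auto simp: differentiable_on_eq_differentiable_at differentiable_def)
    ultimately show ?case by simp
  qed
qed

text \<open>Such a curve is a flow line of the Liouville field in coordinates. \<open>a\<close> and
  \<open>b\<close> vary in the induction because each derivative has the same form, with first
  component 0.\<close>

lemma smooth_on_exp_curve:
  "smooth_on S (\<lambda>s::real. (a :: 'a::real_normed_vector, b * exp s :: real))"
  unfolding smooth_on_def
proof
  fix k
  show "ck_on k S (\<lambda>s. (a, b * exp s))"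
  proof (induction k arbitrary: a b)
    case 0
    show ?case by (auto intro!: continuous_intros)
  next
    case (Suc k)
    have D: "((\<lambda>s. (a, b * exp s)) has_derivative (\<lambda>v. (0, (b * v) * exp s))) (at s)" for s
      by (auto intro!: derivative_eq_intros simp: algebra_simps)
    then have "frechet_derivative (\<lambda>s. (a, b * exp s)) (at s) = (\<lambda>v. (0, (b * v) * exp s))" for s
      using frechet_derivative_at by metis
    moreover have "(\<lambda>s. (a, b * exp s)) differentiable_on S"
      using D by (meson differentiableI differentiable_at_withinI differentiable_on_def)
    ultimately show ?case using Suc.IH by simp
  qed
qed

text \<open>The mean value theorem is applied twice, first along \<open>v\<close> and then along
  \<open>w\<close>. Pairing with \<open>b\<close> makes the functions real-valued, as the theorem
  requires; the point \<open>y\<close> may therefore depend on \<open>b\<close>.\<close>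

lemma second_difference_mean_value:
  fixes f :: "'a::euclidean_space \<Rightarrow> 'b::real_inner"
  assumes f: "smooth_on (ball x d) f" and h: "h > 0" "h * (norm v + norm w) < d"
  shows "\<exists>y\<in>ball x d. (f (x + h *\<^sub>R v + h *\<^sub>R w) - f (x + h *\<^sub>R v) - f (x + h *\<^sub>R w) + f x) \<bullet> b =
           h\<^sup>2 * (frechet_derivative (\<lambda>y. frechet_derivative f (at y) v) (at y) w \<bullet> b)"
proof -
  define fv where "fv y = frechet_derivative f (at y) v" for y
  have fv: "smooth_on (ball x d) fv"
    unfolding fv_def by (rule smooth_on_frechet_derivative[OF f])
  \<comment> \<open>The whole parallelogram spanned by the two increments lies in the ball, hence so
    do all intermediate points.\<close>
  have mem: "x + s *\<^sub>R v + t *\<^sub>R w \<in> ball x d" if "0 \<le> s" "s \<le> h" "0 \<le> t" "t \<le> h" for s t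
  proof -
    have "norm (s *\<^sub>R v + t *\<^sub>R w) \<le> s * norm v + t * norm w"
      using that by (metis norm_triangle_ineq norm_scaleR abs_of_nonneg)
    also have "\<dots> \<le> h * norm v + h * norm w"
      using that by (intro add_mono mult_right_mono) auto
    also have "\<dots> < d" using h by (simp add: algebra_simps)
    finally show ?thesis
      by (simp add: dist_norm flip: norm_minus_cancel[of "_ *\<^sub>R v + _ *\<^sub>R w"])
  qed
  have line: "((\<lambda>s. g (p + s *\<^sub>R u) \<bullet> b) has_real_derivative
        frechet_derivative g (at (p + s *\<^sub>R u)) u \<bullet> b) (at s)"
    if g: "smooth_on (ball x d) g" and "p + s *\<^sub>R u \<in> ball x d"
    for g :: "'a \<Rightarrow> 'b" and p u s
  proof -
    let ?D = "frechet_derivative g (at (p + s *\<^sub>R u))"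
    have D: "(g has_derivative ?D) (at (p + s *\<^sub>R u))"
      using smooth_on_has_derivative[OF g _ that(2)] by simp
    have "((\<lambda>s. g (p + s *\<^sub>R u)) has_derivative (\<lambda>r. ?D (r *\<^sub>R u))) (at s)"
      by (rule has_derivative_compose[of "\<lambda>s. p + s *\<^sub>R u" "\<lambda>r. r *\<^sub>R u" s UNIV g ?D])
         (auto intro!: derivative_eq_intros D)
    then have "((\<lambda>s. g (p + s *\<^sub>R u) \<bullet> b) has_derivative (\<lambda>r. ?D (r *\<^sub>R u) \<bullet> b)) (at s)"
      by (intro derivative_eq_intros) auto
    moreover have "?D (r *\<^sub>R u) = r *\<^sub>R ?D u" for r
      using D has_derivative_linear linear_scale by blast
    ultimately show ?thesis
      by (simp add: has_field_derivative_def mult.commute[of _ "_ \<bullet> b"])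
  qed
  \<comment> \<open>The second difference is the increment, along \<open>v\<close>, of a first
    difference along \<open>w\<close>.\<close>
  let ?G = "\<lambda>s. f (x + h *\<^sub>R w + s *\<^sub>R v) \<bullet> b - f (x + s *\<^sub>R v) \<bullet> b"
  have "\<exists>s>0. s < h \<and> ?G h - ?G 0 = (h - 0) *
      (fv (x + h *\<^sub>R w + s *\<^sub>R v) \<bullet> b - fv (x + s *\<^sub>R v) \<bullet> b)"
  proof (rule MVT2[OF h(1)])
    fix s assume "0 \<le> s" "s \<le> h"
    then show "(?G has_real_derivative
        (fv (x + h *\<^sub>R w + s *\<^sub>R v) \<bullet> b - fv (x + s *\<^sub>R v) \<bullet> b)) (at s)"
      using mem[of s h] mem[of s 0] h(1) unfolding fv_def
      by (intro DERIV_diff line[OF f]) (auto simp: algebra_simps)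
  qed
  then obtain s where s: "0 < s" "s < h" "?G h - ?G 0 = h *
      (fv (x + h *\<^sub>R w + s *\<^sub>R v) \<bullet> b - fv (x + s *\<^sub>R v) \<bullet> b)"
    by auto
  have "\<exists>t>0. t < h \<and> fv (x + s *\<^sub>R v + h *\<^sub>R w) \<bullet> b - fv (x + s *\<^sub>R v + 0 *\<^sub>R w) \<bullet> b =
      (h - 0) * (frechet_derivative fv (at (x + s *\<^sub>R v + t *\<^sub>R w)) w \<bullet> b)"
    using s mem by (intro MVT2[OF h(1)] line[OF fv]) auto
  then obtain t where t: "0 < t" "t < h"
    "fv (x + s *\<^sub>R v + h *\<^sub>R w) \<bullet> b - fv (x + s *\<^sub>R v) \<bullet> b =
      h * (frechet_derivative fv (at (x + s *\<^sub>R v + t *\<^sub>R w)) w \<bullet> b)"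
    by auto
  show ?thesis
  proof (rule bexI)
    show "x + s *\<^sub>R v + t *\<^sub>R w \<in> ball x d" using s t mem by auto
    have "(f (x + h *\<^sub>R v + h *\<^sub>R w) - f (x + h *\<^sub>R v) - f (x + h *\<^sub>R w) + f x) \<bullet> b = ?G h - ?G 0"
      by (simp add: algebra_simps)
    also have "\<dots> = h * (h * (frechet_derivative fv (at (x + s *\<^sub>R v + t *\<^sub>R w)) w \<bullet> b))"
      using s(3) t(3) by (simp add: add.commute add.left_commute)
    finally show "(f (x + h *\<^sub>R v + h *\<^sub>R w) - f (x + h *\<^sub>R v) - f (x + h *\<^sub>R w) + f x) \<bullet> b =
        h\<^sup>2 * (frechet_derivative (\<lambda>y. frechet_derivative f (at y) v) (at (x + s *\<^sub>R v + t *\<^sub>R w)) w \<bullet> b)"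
      by (simp add: fv_def[abs_def] power2_eq_square)
  qed
qed

text \<open>The second difference is symmetric in \<open>v\<close> and \<open>w\<close>, so the two
  mixed derivatives agree at points \<open>y\<close> and \<open>z\<close> arbitrarily close to
  \<open>x\<close>, and continuity carries the equality to \<open>x\<close>.\<close>

lemma second_derivative_symmetric:
  fixes f :: "'a::euclidean_space \<Rightarrow> 'b::real_inner"
  assumes f: "smooth_on S f" and "open S" "x \<in> S"
  shows "frechet_derivative (\<lambda>y. frechet_derivative f (at y) v) (at x) w =
         frechet_derivative (\<lambda>y. frechet_derivative f (at y) w) (at x) v"
proof -
  define D where "D v w y = frechet_derivative (\<lambda>y. frechet_derivative f (at y) v) (at y) w" for v w y
  have "D v w x \<bullet> b = D w v x \<bullet> b" for b
  proof -
    have ev: "\<forall>\<^sub>F y in at x. \<bar>D v w y \<bullet> b - D v w x \<bullet> b\<bar> < e" if "e > 0" for v w e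
    proof -
      have "smooth_on S (D v w)"
        unfolding D_def by (intro smooth_on_frechet_derivative f)
      then have "isCont (D v w) x"
        using assms smooth_on_imp_continuous_on continuous_on_eq_continuous_at by blast
      then have "((\<lambda>y. D v w y \<bullet> b) \<longlongrightarrow> D v w x \<bullet> b) (at x)"
        by (auto intro!: tendsto_intros simp: isCont_def)
      then show ?thesis
        using tendstoD[OF _ that, of "\<lambda>y. D v w y \<bullet> b"] by (simp add: dist_real_def)
    qed
    have "\<bar>D v w x \<bullet> b - D w v x \<bullet> b\<bar> \<le> 2 * e" if e: "e > 0" for e
    proof -
      obtain d1 where d1: "d1 > 0" "ball x d1 \<subseteq> S"
        using assms openE by blast
      obtain d2 where d2: "d2 > 0"
        "\<And>y. y \<noteq> x \<Longrightarrow> dist y x < d2 \<Longrightarrow> \<bar>D v w y \<bullet> b - D v w x \<bullet> b\<bar> < e \<and> \<bar>D w v y \<bullet> b - D w v x \<bullet> b\<bar> < e"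
        using eventually_conj[OF ev[OF e, of v w] ev[OF e, of w v]]
        unfolding eventually_at by auto
      define d where "d = min d1 d2"
      have "d > 0" using d1 d2 by (simp add: d_def)
      have sm: "smooth_on (ball x d) f"
        using f d1 by (intro smooth_on_subset[OF f]) (auto simp: d_def)
      \<comment> \<open>Small enough for the parallelogram to fit into the ball; the summand 1 keeps
        the denominator positive when \<open>v\<close> and \<open>w\<close> are both zero.\<close>
      define h where "h = d / (2 * (norm v + norm w + 1))"
      have h: "h > 0" using \<open>d > 0\<close> by (simp add: h_def add_nonneg_pos)
      have N: "norm v + norm w + 1 > 0" by (simp add: add_nonneg_pos)
      have "h * (norm v + norm w) < h * (2 * (norm v + norm w + 1))"
        using h N by (intro mult_strict_left_mono) (auto simp: add_nonneg_pos)
      also have "\<dots> = d" using N by (simp add: h_def)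
      finally have hd: "h * (norm v + norm w) < d" .
      obtain y where y: "y \<in> ball x d"
        "(f (x + h *\<^sub>R v + h *\<^sub>R w) - f (x + h *\<^sub>R v) - f (x + h *\<^sub>R w) + f x) \<bullet> b = h\<^sup>2 * (D v w y \<bullet> b)"
        using second_difference_mean_value[OF sm h hd, of b] unfolding D_def by blast
      obtain z where z: "z \<in> ball x d"
        "(f (x + h *\<^sub>R w + h *\<^sub>R v) - f (x + h *\<^sub>R w) - f (x + h *\<^sub>R v) + f x) \<bullet> b = h\<^sup>2 * (D w v z \<bullet> b)"
        using second_difference_mean_value[OF sm h, of w v b] hd unfolding D_def
        by (auto simp: add.commute)
      have "f (x + h *\<^sub>R v + h *\<^sub>R w) - f (x + h *\<^sub>R v) - f (x + h *\<^sub>R w) + f x =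
            f (x + h *\<^sub>R w + h *\<^sub>R v) - f (x + h *\<^sub>R w) - f (x + h *\<^sub>R v) + f x"
        by (simp add: algebra_simps)
      then have "h\<^sup>2 * (D v w y \<bullet> b) = h\<^sup>2 * (D w v z \<bullet> b)" using y z by metis
      then have "D v w y \<bullet> b = D w v z \<bullet> b" using h by simp
      \<comment> \<open>The limit at \<open>x\<close> says nothing about the point \<open>x\<close>
        itself, where the bound is trivial; hence the case distinction.\<close>
      moreover have "\<bar>D v w y \<bullet> b - D v w x \<bullet> b\<bar> < e" "\<bar>D w v z \<bullet> b - D w v x \<bullet> b\<bar> < e"
        using d2(2)[of y] d2(2)[of z] y(1) z(1) e
        by (cases "y = x"; cases "z = x"; simp add: d_def dist_commute)+
      ultimately show ?thesis by linarith
    qed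
    \<comment> \<open>With \<open>e\<close> a quarter of the gap, the bound makes the gap at most
      half of itself.\<close>
    from this[of "\<bar>D v w x \<bullet> b - D w v x \<bullet> b\<bar> / 4"] show ?thesis by force
  qed
  then have "D v w x = D w v x" by (metis inner_diff_left inner_eq_zero_iff right_minus_eq)
  then show ?thesis by (simp add: D_def)
qed

section \<open>Alternating forms in odd dimension\<close>

text \<open>Induction on the dimension: a plane spanned by \<open>v\<close> and \<open>w\<close>
  with \<open>B v w = 1\<close> splits off, and the form stays nondegenerate on its
  \<open>B\<close>-orthogonal complement \<open>W\<close> in \<open>V\<close>, whose dimension is
  smaller by 2.\<close>

lemma nondegenerate_alternating_even_dim:
  fixes B :: "'a::euclidean_space \<Rightarrow> 'a \<Rightarrow> real"
  assumes B: "bilinear B" and alt: "\<And>x. B x x = 0"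
    and "subspace V" "\<And>x. x \<in> V \<Longrightarrow> (\<And>y. y \<in> V \<Longrightarrow> B x y = 0) \<Longrightarrow> x = 0"
  shows "even (dim V)"
  using assms(3,4)
proof (induction "dim V" arbitrary: V rule: less_induct)
  case less
  note nondeg = less.prems(2)
  have skew: "B x y = - B y x" for x y
  proof -
    have "B (x + y) (x + y) = B x x + B x y + (B y x + B y y)"
      by (simp add: bilinear_ladd[OF B] bilinear_radd[OF B])
    then show ?thesis by (simp add: alt)
  qed
  note Bs = bilinear_ladd[OF B] bilinear_radd[OF B] bilinear_lmul[OF B] bilinear_rmul[OF B]
    bilinear_lsub[OF B] bilinear_rsub[OF B] bilinear_lzero[OF B] bilinear_rzero[OF B]
  show ?case
  proof (cases "V \<subseteq> {0}")
    case True
    then show ?thesis by (metis dim_eq_0 even_zero)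
  next
    case False
    then obtain v w' where v: "v \<in> V" "w' \<in> V" "B v w' \<noteq> 0"
      using nondeg by blast
    define w where "w = (1 / B v w') *\<^sub>R w'"
    have w: "w \<in> V" "B v w = 1" "B w v = -1"
      using v less.prems(1) skew[of w v] by (auto simp: w_def subspace_mul Bs)
    define W where "W = {x\<in>V. B v x = 0 \<and> B w x = 0}"
    have subW: "subspace W"
      using less.prems(1) unfolding W_def subspace_def by (auto simp: Bs)
    \<comment> \<open>As \<open>B v w = 1\<close> and \<open>B w v = -1\<close>, the coefficients
      \<open>- B w x\<close> and \<open>B v x\<close> are the ones that leave a remainder orthogonal
      to both \<open>v\<close> and \<open>w\<close>.\<close>
    have split: "\<exists>x'\<in>W. \<exists>s t. x = x' + (s *\<^sub>R v + t *\<^sub>R w)" if "x \<in> V" for x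
    proof (intro bexI exI)
      show "x = (x - (- B w x *\<^sub>R v + B v x *\<^sub>R w)) + (- B w x *\<^sub>R v + B v x *\<^sub>R w)" by simp
      show "x - (- B w x *\<^sub>R v + B v x *\<^sub>R w) \<in> W"
        using that v w less.prems(1) alt unfolding W_def
        by (auto simp: Bs subspace_diff subspace_add subspace_mul subspace_neg)
    qed
    \<comment> \<open>A vector of \<open>W\<close> annihilates the plane; if it also annihilates
      \<open>W\<close>, it annihilates all of \<open>V\<close>.\<close>
    have "x = 0" if x: "x \<in> W" "\<And>y. y \<in> W \<Longrightarrow> B x y = 0" for x
    proof (rule nondeg)
      show "x \<in> V" using x by (simp add: W_def)
      fix y assume "y \<in> V"
      then obtain y' s t where "y' \<in> W" "y = y' + (s *\<^sub>R v + t *\<^sub>R w)" using split by blast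
      then show "B x y = 0" using x skew[of x v] skew[of x w] by (simp add: Bs W_def)
    qed
    moreover
    have ind: "W \<inter> span {v, w} = {0}"
    proof -
      have "x = 0" if x: "x \<in> W" "x \<in> span {v, w}" for x
      proof -
        obtain s t where "x = s *\<^sub>R v + t *\<^sub>R w"
          using x(2) by (auto simp: span_breakdown_eq) (metis diff_eq_eq add.commute)
        then show ?thesis using x(1) w alt by (simp add: W_def Bs)
      qed
      then show ?thesis using subW by (auto simp: subspace_0 span_zero)
    qed
    have "independent {v, w}" "v \<noteq> w"
    proof -
      show "v \<noteq> w" using alt w by force
      have "w \<noteq> 0" using w Bs by force
      have "v \<notin> span {w}"
        using w alt by (auto simp: span_singleton Bs)
      then show "independent {v, w}"
        using \<open>w \<noteq> 0\<close> \<open>v \<noteq> w\<close> by (simp add: independent_insert)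
    qed
    then have "dim (span {v, w}) = 2" by (simp add: dim_eq_card_independent)
    moreover have "{x + y |x y. x \<in> W \<and> y \<in> span {v, w}} = V"
    proof
      show "{x + y |x y. x \<in> W \<and> y \<in> span {v, w}} \<subseteq> V"
      proof -
        have "span {v, w} \<subseteq> V" using v w less.prems(1) by (intro span_minimal) auto
        then show ?thesis using less.prems(1) by (auto simp: W_def subspace_add)
      qed
      show "V \<subseteq> {x + y |x y. x \<in> W \<and> y \<in> span {v, w}}"
      proof
        fix x assume "x \<in> V"
        then obtain x' s t where "x' \<in> W" "x = x' + (s *\<^sub>R v + t *\<^sub>R w)" using split by blast
        moreover have "s *\<^sub>R v + t *\<^sub>R w \<in> span {v, w}"
          by (simp add: span_add span_base span_mul)
        ultimately show "x \<in> {x + y |x y. x \<in> W \<and> y \<in> span {v, w}}" by blast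
      qed
    qed
    ultimately have "dim V = dim W + 2"
      using dim_sums_Int[OF subW subspace_span[of "{v, w}"]] ind by simp
    then show ?thesis
      using less.hyps[OF _ subW] \<open>\<And>x. x \<in> W \<Longrightarrow> (\<And>y. y \<in> W \<Longrightarrow> B x y = 0) \<Longrightarrow> x = 0\<close> by simp
  qed
qed

text \<open>Applied to \<open>d\<eta>\<close> at a point of a contact manifold, the vector
  \<open>r\<close> spans the Reeb direction.\<close>

lemma alternating_odd_radical:
  fixes B :: "'a::euclidean_space \<Rightarrow> 'a \<Rightarrow> real"
  assumes "bilinear B" "\<And>x. B x x = 0" "odd DIM('a)"
  obtains r where "r \<noteq> 0" "\<And>y. B r y = 0"
proof -
  have "\<not> (\<forall>r. (\<forall>y. B r y = 0) \<longrightarrow> r = 0)"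
    using nondegenerate_alternating_even_dim[OF assms(1,2) subspace_UNIV] assms(3) by force
  then show ?thesis using that by blast
qed

section \<open>Exterior derivatives in charts\<close>

text \<open>Naturality of the exterior derivative under pullback by \<phi>. Besides the wanted term,
  the product rule yields \<alpha> applied to a second derivative of \<phi>; this is symmetric in
  \<open>v\<close> and \<open>w\<close> and cancels in the difference.\<close>

lemma pullback_ext_deriv:
  fixes \<phi> :: "'a::euclidean_space \<Rightarrow> 'b::euclidean_space" and \<alpha> :: "'b \<Rightarrow> 'b \<Rightarrow> real"
  defines "D \<equiv> \<lambda>x. frechet_derivative \<phi> (at x)"
  assumes \<phi>: "smooth_on U \<phi>" "open U" "y \<in> U" and V: "open V" "\<phi> ` U \<subseteq> V"
    and lin: "\<And>z. z \<in> V \<Longrightarrow> linear (\<alpha> z)"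
    and diff: "\<And>u. (\<lambda>z. \<alpha> z u) differentiable (at (\<phi> y))"
    and \<beta>: "\<And>x u. x \<in> U \<Longrightarrow> \<beta> x u = \<alpha> (\<phi> x) (D x u)"
  shows "frechet_derivative (\<lambda>x. \<beta> x w) (at y) v - frechet_derivative (\<lambda>x. \<beta> x v) (at y) w =
         frechet_derivative (\<lambda>z. \<alpha> z (D y w)) (at (\<phi> y)) (D y v) -
         frechet_derivative (\<lambda>z. \<alpha> z (D y v)) (at (\<phi> y)) (D y w)"
proof -
  define D2 where "D2 w = frechet_derivative (\<lambda>x. D x w) (at y)" for w
  have y: "\<phi> y \<in> V" using \<phi> V by blast
  \<comment> \<open>Expansion in a basis turns \<open>\<alpha> (\<phi> x) (D x w)\<close>, which
    depends on \<open>x\<close> through both arguments, into a finite sum of products.\<close>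
  have expand: "f u = (\<Sum>b\<in>Basis. (u \<bullet> b) * f b)" if "linear f" for f :: "'b \<Rightarrow> real" and u
  proof -
    have "f u = f (\<Sum>b\<in>Basis. (u \<bullet> b) *\<^sub>R b)" by (simp add: euclidean_representation)
    also have "\<dots> = (\<Sum>b\<in>Basis. (u \<bullet> b) * f b)"
      using that by (simp add: linear_sum linear_scale)
    finally show ?thesis .
  qed
  define d\<alpha> where "d\<alpha> u = frechet_derivative (\<lambda>z. \<alpha> z u) (at (\<phi> y))" for u
  have d\<alpha>: "((\<lambda>z. \<alpha> z u) has_derivative d\<alpha> u) (at (\<phi> y))" for u
    using diff unfolding d\<alpha>_def frechet_derivative_works .
  have d\<alpha>_expand: "d\<alpha> u = (\<lambda>h. \<Sum>b\<in>Basis. (u \<bullet> b) * d\<alpha> b h)" for u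
  proof -
    have "((\<lambda>z. \<Sum>b\<in>Basis. (u \<bullet> b) * \<alpha> z b) has_derivative
        (\<lambda>h. \<Sum>b\<in>Basis. (u \<bullet> b) * d\<alpha> b h)) (at (\<phi> y))"
      by (intro has_derivative_sum has_derivative_mult_right d\<alpha>)
    then have "((\<lambda>z. \<alpha> z u) has_derivative (\<lambda>h. \<Sum>b\<in>Basis. (u \<bullet> b) * d\<alpha> b h)) (at (\<phi> y))"
      by (rule has_derivative_transform_within_open[OF _ V(1) y]) (metis expand lin)
    then show ?thesis using d\<alpha> has_derivative_unique by blast
  qed
  have \<phi>': "(\<phi> has_derivative D y) (at y)"
    unfolding D_def by (rule smooth_on_has_derivative[OF \<phi>])
  have D2: "((\<lambda>x. D x w) has_derivative D2 w) (at y)" for w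
    unfolding D_def D2_def
    by (rule smooth_on_has_derivative[OF smooth_on_frechet_derivative[OF \<phi>(1)] \<phi>(2,3)])
  have "frechet_derivative (\<lambda>x. \<beta> x w) (at y) v = \<alpha> (\<phi> y) (D2 w v) + d\<alpha> (D y w) (D y v)" for v w
  proof -
    have "((\<lambda>x. \<Sum>b\<in>Basis. (D x w \<bullet> b) * \<alpha> (\<phi> x) b) has_derivative
        (\<lambda>v. \<Sum>b\<in>Basis. (D y w \<bullet> b) * d\<alpha> b (D y v) + (D2 w v \<bullet> b) * \<alpha> (\<phi> y) b)) (at y)"
      by (intro has_derivative_sum has_derivative_mult has_derivative_inner_left D2
          has_derivative_compose[OF \<phi>' d\<alpha>])
    then have "((\<lambda>x. \<beta> x w) has_derivative
        (\<lambda>v. \<Sum>b\<in>Basis. (D y w \<bullet> b) * d\<alpha> b (D y v) + (D2 w v \<bullet> b) * \<alpha> (\<phi> y) b)) (at y)"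
      by (rule has_derivative_transform_within_open[OF _ \<phi>(2,3)])
        (use V(2) in \<open>simp add: \<beta> expand[OF lin] image_subset_iff\<close>)
    from frechet_derivative_at[OF this, symmetric] show ?thesis
      by (simp add: sum.distrib expand[OF lin[OF y], of "D2 w v"] d\<alpha>_expand[of "D y w"])
  qed
  moreover have "D2 w v = D2 v w"
    using second_derivative_symmetric[OF \<phi>] unfolding D_def D2_def .
  ultimately show ?thesis by (simp add: d\<alpha>_def)
qed

section \<open>Tangent vectors under change of charts\<close>

abbreviation jacobian :: "('m, 'e::euclidean_space) chart \<Rightarrow> ('m, 'e) chart \<Rightarrow> 'm \<Rightarrow> 'e \<Rightarrow> 'e" where
  "jacobian c d p \<equiv> frechet_derivative (snd d \<circ> chart_inv c) (at (snd c p))"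

lemma chart_at_mem: "p \<in> points A \<Longrightarrow> chart_at A p \<in> A \<and> p \<in> fst (chart_at A p)"
  unfolding chart_at_def points_def by (rule someI_ex) auto

lemma tangent_of_apply:
  "d \<in> A \<Longrightarrow> p \<in> fst d \<Longrightarrow> tangent_of A p c u d = jacobian c d p u"
  by (simp add: tangent_of_def)

context
  fixes A :: "('m, 'e::euclidean_space) chart set"
  assumes atlas: "smooth_atlas A"
begin

lemma chart_inv_chart: "c \<in> A \<Longrightarrow> p \<in> fst c \<Longrightarrow> chart_inv c (snd c p) = p"
  using atlas by (simp add: smooth_atlas_def chart_inv_def)

lemma open_chart_image: "c \<in> A \<Longrightarrow> open (snd c ` fst c)"
  using atlas by (simp add: smooth_atlas_def)

lemma open_overlap: "c \<in> A \<Longrightarrow> d \<in> A \<Longrightarrow> open (snd c ` (fst c \<inter> fst d))"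
  using atlas by (simp add: smooth_atlas_def)

lemma smooth_transition:
  "c \<in> A \<Longrightarrow> d \<in> A \<Longrightarrow> smooth_on (snd c ` (fst c \<inter> fst d)) (snd d \<circ> chart_inv c)"
  using atlas by (simp add: smooth_atlas_def)

lemma transition_has_derivative:
  assumes "c \<in> A" "d \<in> A" "p \<in> fst c" "p \<in> fst d"
  shows "(snd d \<circ> chart_inv c has_derivative jacobian c d p) (at (snd c p))"
  by (rule smooth_on_has_derivative[OF smooth_transition open_overlap]) (use assms in auto)

lemma jacobian_self:
  assumes "c \<in> A" "p \<in> fst c"
  shows "jacobian c c p = (\<lambda>u. u)"
proof -
  have "(snd c \<circ> chart_inv c has_derivative (\<lambda>u. u)) (at (snd c p))"
    by (rule has_derivative_transform_within_open[OF has_derivative_ident open_chart_image])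
      (use assms in \<open>auto simp: chart_inv_chart\<close>)
  then show ?thesis using frechet_derivative_at by metis
qed

text \<open>The chain rule: on the overlap of \<open>c\<close> and \<open>d\<close>, an open set
  around the point, the composite of the transitions is the direct transition.\<close>

lemma jacobian_compose:
  assumes "c \<in> A" "d \<in> A" "e \<in> A" "p \<in> fst c" "p \<in> fst d" "p \<in> fst e"
  shows "jacobian d e p (jacobian c d p u) = jacobian c e p u"
proof -
  have eq: "(snd d \<circ> chart_inv c) (snd c p) = snd d p"
    using assms by (simp add: chart_inv_chart)
  have "((snd e \<circ> chart_inv d) \<circ> (snd d \<circ> chart_inv c) has_derivative
      jacobian d e p \<circ> jacobian c d p) (at (snd c p))"
    by (intro diff_chain_at transition_has_derivative assms)
      (unfold eq, intro transition_has_derivative assms)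
  then have "(snd e \<circ> chart_inv c has_derivative jacobian d e p \<circ> jacobian c d p) (at (snd c p))"
    by (rule has_derivative_transform_within_open[OF _ open_overlap[OF assms(1,2)]])
      (use assms in \<open>auto simp: chart_inv_chart\<close>)
  then show ?thesis using frechet_derivative_at by (metis comp_apply)
qed

lemma tangent_of_self: "c \<in> A \<Longrightarrow> p \<in> fst c \<Longrightarrow> tangent_of A p c u c = u"
  by (simp add: tangent_of_apply jacobian_self)

lemma tangent_of_mem:
  "c \<in> A \<Longrightarrow> p \<in> fst c \<Longrightarrow> tangent_of A p c u \<in> tangent_space A p"
  by (auto simp: tangent_space_def tangent_of_def jacobian_compose)

lemma tangent_space_transition:
  "v \<in> tangent_space A p \<Longrightarrow> c \<in> A \<Longrightarrow> d \<in> A \<Longrightarrow> p \<in> fst c \<Longrightarrow> p \<in> fst d \<Longrightarrow>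
    v d = jacobian c d p (v c)"
  unfolding tangent_space_def by blast

lemma tangent_of_change_chart:
  "c \<in> A \<Longrightarrow> d \<in> A \<Longrightarrow> p \<in> fst c \<Longrightarrow> p \<in> fst d \<Longrightarrow>
    tangent_of A p d (jacobian c d p u) = tangent_of A p c u"
  by (rule ext) (simp add: tangent_of_def jacobian_compose)

lemma tangent_of_linear:
  assumes "c \<in> A" "p \<in> fst c"
  shows "tangent_of A p c (a *\<^sub>R u + b *\<^sub>R w) =
    (\<lambda>d. a *\<^sub>R tangent_of A p c u d + b *\<^sub>R tangent_of A p c w d)"
proof
  fix d
  show "tangent_of A p c (a *\<^sub>R u + b *\<^sub>R w) d = a *\<^sub>R tangent_of A p c u d + b *\<^sub>R tangent_of A p c w d"
  proof (cases "d \<in> A \<and> p \<in> fst d")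
    case True
    then have "linear (jacobian c d p)"
      using transition_has_derivative assms has_derivative_linear by blast
    then show ?thesis
      using True by (simp add: tangent_of_apply linear_add linear_scale)
  qed (auto simp: tangent_of_def)
qed

end

section \<open>One-forms and their exterior derivatives in coordinates\<close>

definition form_coord ::
    "('m, 'e::euclidean_space) chart set \<Rightarrow> ('m \<Rightarrow> ('m, 'e) tangent \<Rightarrow> real) \<Rightarrow>
     ('m, 'e) chart \<Rightarrow> 'e \<Rightarrow> 'e \<Rightarrow> real" where
  "form_coord A \<alpha> c x u = \<alpha> (chart_inv c x) (tangent_of A (chart_inv c x) c u)"

text \<open>\<open>ext_deriv\<close> is tied to the chart picked by \<open>chart_at\<close>; here
  the chart is an argument, so that different charts can be compared.\<close>

definition ext_deriv_coord ::
    "('m, 'e::euclidean_space) chart set \<Rightarrow> ('m \<Rightarrow> ('m, 'e) tangent \<Rightarrow> real) \<Rightarrow>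
     ('m, 'e) chart \<Rightarrow> 'e \<Rightarrow> 'e \<Rightarrow> 'e \<Rightarrow> real" where
  "ext_deriv_coord A \<alpha> c x v w =
     frechet_derivative (\<lambda>x. form_coord A \<alpha> c x w) (at x) v -
     frechet_derivative (\<lambda>x. form_coord A \<alpha> c x v) (at x) w"

lemma ext_deriv_eq_coord_chart_at:
  "ext_deriv A \<alpha> p v w =
    ext_deriv_coord A \<alpha> (chart_at A p) (snd (chart_at A p) p) (v (chart_at A p)) (w (chart_at A p))"
  by (simp add: ext_deriv_def ext_deriv_coord_def form_coord_def[abs_def] Let_def)

lemma ext_deriv_skew: "ext_deriv A \<alpha> p v w = - ext_deriv A \<alpha> p w v"
  by (simp add: ext_deriv_def Let_def)

context
  fixes A :: "('m, 'e::euclidean_space) chart set" and \<alpha> :: "'m \<Rightarrow> ('m, 'e) tangent \<Rightarrow> real"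
  assumes atlas: "smooth_atlas A" and form: "one_form A \<alpha>"
begin

lemma form_coord_linear:
  assumes "c \<in> A" "x \<in> snd c ` fst c"
  shows "linear (form_coord A \<alpha> c x)"
proof -
  obtain p where p: "p \<in> fst c" "x = snd c p" using assms by blast
  then have "p \<in> points A" using assms by (auto simp: points_def)
  then have "form_coord A \<alpha> c x (a *\<^sub>R u + b *\<^sub>R w) = a * form_coord A \<alpha> c x u + b * form_coord A \<alpha> c x w"
    for a b u w
    using form assms p
    by (simp add: form_coord_def chart_inv_chart[OF atlas] tangent_of_linear[OF atlas]
        tangent_of_mem[OF atlas] one_form_def)
  from this[of 1 _ 1] this[of _ _ 0 0] show ?thesis
    by (intro linearI) simp_all
qed

lemma form_coord_has_derivative:
  assumes "c \<in> A" "x \<in> snd c ` fst c"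
  shows "((\<lambda>x. form_coord A \<alpha> c x u) has_derivative
    frechet_derivative (\<lambda>x. form_coord A \<alpha> c x u) (at x)) (at x)"
proof (rule smooth_on_has_derivative[OF _ open_chart_image[OF atlas assms(1)] assms(2)])
  show "smooth_on (snd c ` fst c) (\<lambda>x. form_coord A \<alpha> c x u)"
    using form assms by (simp add: form_coord_def one_form_def)
qed

text \<open>The coordinate form in \<open>c\<close> is the pullback of the one in \<open>d\<close>
  along the transition map, so naturality of the exterior derivative applies.\<close>

lemma ext_deriv_coord_change_chart:
  assumes "c \<in> A" "d \<in> A" "p \<in> fst c" "p \<in> fst d"
  shows "ext_deriv_coord A \<alpha> c (snd c p) v w =
    ext_deriv_coord A \<alpha> d (snd d p) (jacobian c d p v) (jacobian c d p w)"
proof -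
  let ?\<phi> = "snd d \<circ> chart_inv c" and ?U = "snd c ` (fst c \<inter> fst d)"
  have \<phi>p: "?\<phi> (snd c p) = snd d p"
    using assms by (simp add: chart_inv_chart[OF atlas])
  have im: "?\<phi> ` ?U \<subseteq> snd d ` fst d"
    using assms by (auto simp: chart_inv_chart[OF atlas])
  show ?thesis
    unfolding ext_deriv_coord_def \<phi>p[symmetric]
  proof (rule pullback_ext_deriv[OF smooth_transition[OF atlas assms(1,2)]
        open_overlap[OF atlas assms(1,2)] _ open_chart_image[OF atlas assms(2)] im])
    show "snd c p \<in> ?U" using assms by blast
    show "linear (form_coord A \<alpha> d z)" if "z \<in> snd d ` fst d" for z
      using form_coord_linear[OF assms(2) that] .
    show "(\<lambda>z. form_coord A \<alpha> d z u) differentiable (at (?\<phi> (snd c p)))" for u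
      unfolding \<phi>p by (rule differentiableI[OF form_coord_has_derivative]) (use assms in auto)
    show "form_coord A \<alpha> c x u = form_coord A \<alpha> d (?\<phi> x) (frechet_derivative ?\<phi> (at x) u)"
      if x: "x \<in> ?U" for x u
    proof -
      obtain q where "q \<in> fst c" "q \<in> fst d" "x = snd c q" using x by blast
      then show ?thesis
        using assms by (simp add: form_coord_def chart_inv_chart[OF atlas]
            tangent_of_change_chart[OF atlas])
    qed
  qed
qed

text \<open>Frees the exterior derivative from the choice made by \<open>chart_at\<close>: tangent
  vectors transform by the same jacobian as the coordinate forms.\<close>

lemma ext_deriv_eq_coord:
  assumes "c \<in> A" "p \<in> fst c" "v \<in> tangent_space A p" "w \<in> tangent_space A p"
  shows "ext_deriv A \<alpha> p v w = ext_deriv_coord A \<alpha> c (snd c p) (v c) (w c)"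
proof -
  define d where "d = chart_at A p"
  have "p \<in> points A" using assms by (auto simp: points_def)
  from chart_at_mem[OF this] have d: "d \<in> A" "p \<in> fst d" by (simp_all add: d_def)
  show ?thesis
    unfolding ext_deriv_eq_coord_chart_at d_def[symmetric]
    by (simp only: ext_deriv_coord_change_chart[OF assms(1) d(1) assms(2) d(2)]
        tangent_space_transition[OF atlas assms(3) assms(1) d(1) assms(2) d(2)]
        tangent_space_transition[OF atlas assms(4) assms(1) d(1) assms(2) d(2)])
qed

lemma ext_deriv_coord_bilinear:
  assumes "c \<in> A" "x \<in> snd c ` fst c"
  shows "bilinear (ext_deriv_coord A \<alpha> c x)"
proof -
  let ?D = "\<lambda>u. frechet_derivative (\<lambda>x. form_coord A \<alpha> c x u) (at x)"
  have D: "((\<lambda>x. form_coord A \<alpha> c x u) has_derivative ?D u) (at x)" for u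
    using form_coord_has_derivative[OF assms] .
  \<comment> \<open>Linearity in the direction is part of being a derivative; linearity in the
    vector inserted into the form follows from uniqueness of derivatives.\<close>
  have "?D (a *\<^sub>R u + b *\<^sub>R w) = (\<lambda>h. a * ?D u h + b * ?D w h)" for a b u w
  proof -
    have "((\<lambda>x. a * form_coord A \<alpha> c x u + b * form_coord A \<alpha> c x w) has_derivative
        (\<lambda>h. a * ?D u h + b * ?D w h)) (at x)"
      by (intro has_derivative_add has_derivative_mult_right D)
    then have "((\<lambda>x. form_coord A \<alpha> c x (a *\<^sub>R u + b *\<^sub>R w)) has_derivative
        (\<lambda>h. a * ?D u h + b * ?D w h)) (at x)"
      by (rule has_derivative_transform_within_open[OF _ open_chart_image[OF atlas assms(1)] assms(2)])
        (simp add: linear_add linear_scale form_coord_linear[OF assms(1)])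
    then show ?thesis using D has_derivative_unique by blast
  qed
  from this[of 1 _ 1] this[of _ _ 0 0]
  have Dlin: "?D (u + w) = (\<lambda>h. ?D u h + ?D w h)" "?D (a *\<^sub>R u) = (\<lambda>h. a * ?D u h)" for a u w
    by simp_all
  have "linear (?D u)" for u using D has_derivative_linear by blast
  then show ?thesis
    unfolding bilinear_def ext_deriv_coord_def
    by (intro conjI allI linearI) (simp_all add: Dlin linear_add linear_scale algebra_simps)
qed

end

section \<open>Differentials of functions along curves\<close>

lemma topspace_manifold_topology: "topspace (manifold_topology A) = points A"
proof
  show "topspace (manifold_topology A) \<subseteq> points A"
    unfolding manifold_topology_def points_def topology_generated_by_topspace by blast
  show "points A \<subseteq> topspace (manifold_topology A)"
  proof
    fix p assume "p \<in> points A"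
    then obtain c where "c \<in> A" "p \<in> {p \<in> fst c. snd c p \<in> UNIV}"
      by (auto simp: points_def)
    then show "p \<in> topspace (manifold_topology A)"
      unfolding manifold_topology_def topology_generated_by_topspace using open_UNIV by blast
  qed
qed

text \<open>The chain rule through the chart that \<open>differential\<close> selects. The preimage
  of the chart domain under the curve is open, so the curve stays in the domain for times near
  \<open>t\<close>.\<close>

lemma velocity_differential:
  assumes A: "smooth_atlas A" and f: "smooth_function A f"
    and \<gamma>: "smooth_curve A J \<gamma>" "t \<in> J"
  shows "((f \<circ> \<gamma>) has_real_derivative differential A f (\<gamma> t) (velocity A \<gamma> t)) (at t)"
proof -
  define c where "c = chart_at A (\<gamma> t)"
  have "\<gamma> ` J \<subseteq> topspace (manifold_topology A)"
    using \<gamma>(1) continuous_map_image_subset_topspace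
    unfolding smooth_curve_def by fastforce
  then have "\<gamma> t \<in> points A" using \<gamma>(2) by (auto simp: topspace_manifold_topology)
  from chart_at_mem[OF this] have c: "c \<in> A" "\<gamma> t \<in> fst c" by (simp_all add: c_def)
  define T where "T = {s \<in> J. \<gamma> s \<in> fst c}"
  have "openin (manifold_topology A) {p \<in> fst c. snd c p \<in> UNIV}"
    unfolding manifold_topology_def
    by (intro topology_generated_by_Basis CollectI exI conjI) (rule refl c open_UNIV)+
  then have "openin (top_of_set J) {s \<in> topspace (top_of_set J). \<gamma> s \<in> fst c}"
    using \<gamma> unfolding smooth_curve_def by (intro openin_continuous_map_preimage) auto
  then have T: "open T" "t \<in> T"
    using \<gamma> c openin_open_trans by (auto simp: T_def smooth_curve_def)
  have "smooth_on T (snd c \<circ> \<gamma>)" using \<gamma> c by (simp add: smooth_curve_def T_def)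
  then have "(snd c \<circ> \<gamma>) differentiable (at t)"
    using smooth_on_has_derivative T differentiableI by blast
  then have v: "((snd c \<circ> \<gamma>) has_derivative (\<lambda>h. h *\<^sub>R velocity A \<gamma> t c)) (at t)"
    using c by (simp add: velocity_def vector_derivative_works flip: has_vector_derivative_def)
  let ?f = "f \<circ> chart_inv c"
  let ?D = "frechet_derivative ?f (at (snd c (\<gamma> t)))"
  have D: "(?f has_derivative ?D) (at ((snd c \<circ> \<gamma>) t))"
    using smooth_on_has_derivative[of "snd c ` fst c" ?f "snd c (\<gamma> t)"]
      open_chart_image[OF A] f c by (simp add: smooth_function_def)
  have "(?f \<circ> (snd c \<circ> \<gamma>) has_derivative ?D \<circ> (\<lambda>h. h *\<^sub>R velocity A \<gamma> t c)) (at t)"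
    by (rule diff_chain_at[OF v D])
  then have "(f \<circ> \<gamma> has_derivative ?D \<circ> (\<lambda>h. h *\<^sub>R velocity A \<gamma> t c)) (at t)"
    by (rule has_derivative_transform_within_open[OF _ T])
      (use c in \<open>simp add: T_def chart_inv_chart[OF A]\<close>)
  moreover have "?D \<circ> (\<lambda>h. h *\<^sub>R velocity A \<gamma> t c) = (*) (?D (velocity A \<gamma> t c))"
    using has_derivative_linear[OF D] by (auto simp: linear_scale fun_eq_iff)
  ultimately show ?thesis
    by (simp add: has_field_derivative_def differential_def Let_def c_def)
qed

lemma differential_velocity_eq_0:
  assumes A: "smooth_atlas A" and f: "smooth_function A f" and \<gamma>: "smooth_curve A J \<gamma>" "t \<in> J"
    and const: "f constant_on (\<gamma> ` J)"
  shows "differential A f (\<gamma> t) (velocity A \<gamma> t) = 0"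
proof -
  obtain a where a: "f (\<gamma> s) = a" if "s \<in> J" for s
    using const unfolding constant_on_def by blast
  have "open J" using \<gamma> by (simp add: smooth_curve_def)
  have "((\<lambda>_. a) has_real_derivative 0) (at t)" by simp
  then have "((f \<circ> \<gamma>) has_real_derivative 0) (at t)"
    by (rule has_field_derivative_transform_within_open[OF _ \<open>open J\<close> \<gamma>(2)]) (simp add: a)
  then show ?thesis using velocity_differential[OF A f \<gamma>] DERIV_unique by blast
qed

section \<open>The symplectic cover\<close>

text \<open>A single chart of \<open>cover_atlas\<close>, named so that charts of the cover can be
  indexed by charts of the base.\<close>

definition cover_chart ::
    "('m, 'e::euclidean_space) chart set \<Rightarrow> ('m \<Rightarrow> ('m, 'e) covector) \<Rightarrow> ('m, 'e) chart \<Rightarrow>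
     ('m \<times> ('m, 'e) covector, 'e \<times> real) chart" where
  "cover_chart A \<eta> c =
     ({q \<in> symplectic_cover A \<eta>. fst q \<in> fst c}, \<lambda>q. (snd c (fst q), fibre_coord \<eta> q))"

lemma cover_atlas_eq: "cover_atlas A \<eta> = cover_chart A \<eta> ` A"
  by (simp add: cover_atlas_def cover_chart_def[abs_def])

lemma points_cover_atlas: "points (cover_atlas A \<eta>) = symplectic_cover A \<eta>"
  by (auto simp: cover_atlas_eq cover_chart_def points_def symplectic_cover_def)

section \<open>The fibre coordinate and the atlas of the cover\<close>

context
  fixes n :: nat and A :: "('m, 'e::euclidean_space) chart set"
    and \<eta> :: "'m \<Rightarrow> ('m, 'e) covector"
  assumes contact: "cooriented_contact n A \<eta>"
begin

lemma contact_atlas: "smooth_atlas A"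
  using contact by (simp add: cooriented_contact_def smooth_manifold_def)

lemma contact_one_form: "one_form A \<eta>"
  using contact by (simp add: cooriented_contact_def)

text \<open>As \<eta> vanishes at no point, a multiple of it determines the scalar, and the definite
  description in \<open>fibre_coord\<close> has exactly one solution.\<close>

lemma fibre_coord_scaled:
  assumes "p \<in> points A"
  shows "fibre_coord \<eta> (p, \<lambda>v. s * \<eta> p v) = s"
proof -
  obtain v where "\<eta> p v \<noteq> 0" using contact assms unfolding cooriented_contact_def by blast
  then have "s = s'" if "(\<lambda>v. s * \<eta> p v) = (\<lambda>v. s' * \<eta> p v)" for s'
    using fun_cong[OF that, of v] by simp
  then show ?thesis unfolding fibre_coord_def by (intro the_equality) auto
qed

lemma scaled_mem_cover:
  "p \<in> points A \<Longrightarrow> s \<noteq> 0 \<Longrightarrow> (p, \<lambda>v. s * \<eta> p v) \<in> symplectic_cover A \<eta>"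
  by (auto simp: symplectic_cover_def)

lemma
  assumes "q \<in> symplectic_cover A \<eta>"
  shows fst_cover_mem: "fst q \<in> points A"
    and fibre_coord_nonzero: "fibre_coord \<eta> q \<noteq> 0"
    and cover_point_eq: "q = (fst q, \<lambda>v. fibre_coord \<eta> q * \<eta> (fst q) v)"
proof -
  obtain p s where q: "q = (p, \<lambda>v. s * \<eta> p v)" "p \<in> points A" "s \<noteq> 0"
    using assms unfolding symplectic_cover_def by blast
  then have "fibre_coord \<eta> q = s" using fibre_coord_scaled by simp
  then show "fst q \<in> points A" "fibre_coord \<eta> q \<noteq> 0"
      "q = (fst q, \<lambda>v. fibre_coord \<eta> q * \<eta> (fst q) v)"
    using q by simp_all
qed

text \<open>Every fibre is a full punctured line in every chart, so overlaps are products. A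
  preimage of \<open>z\<close> is the base point together with \<eta> scaled by
  \<open>snd z\<close>.\<close>

lemma cover_chart_overlap:
  assumes "c \<in> A"
  shows "snd (cover_chart A \<eta> c) ` (fst (cover_chart A \<eta> c) \<inter> fst (cover_chart A \<eta> d)) =
    (snd c ` (fst c \<inter> fst d)) \<times> (- {0})" (is "?l = ?r")
proof
  show "?l \<subseteq> ?r"
    by (auto simp: cover_chart_def fibre_coord_nonzero)
  show "?r \<subseteq> ?l"
  proof
    fix z assume "z \<in> ?r"
    then obtain p where p: "p \<in> fst c" "p \<in> fst d" "fst z = snd c p" "snd z \<noteq> 0"
      unfolding mem_Times_iff by blast
    then have "p \<in> points A" using assms by (auto simp: points_def)
    then have "z = snd (cover_chart A \<eta> c) (p, \<lambda>v. snd z * \<eta> p v)"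
      "(p, \<lambda>v. snd z * \<eta> p v) \<in> fst (cover_chart A \<eta> c) \<inter> fst (cover_chart A \<eta> d)"
      using p by (auto simp: cover_chart_def fibre_coord_scaled scaled_mem_cover prod_eq_iff)
    then show "z \<in> ?l" by blast
  qed
qed

lemma cover_chart_image:
  "c \<in> A \<Longrightarrow> snd (cover_chart A \<eta> c) ` fst (cover_chart A \<eta> c) = (snd c ` fst c) \<times> (- {0})"
  using cover_chart_overlap[of c c] by simp

lemma inj_on_cover_chart:
  assumes "c \<in> A"
  shows "inj_on (snd (cover_chart A \<eta> c)) (fst (cover_chart A \<eta> c))"
proof (rule inj_onI)
  fix q q'
  assume q: "q \<in> fst (cover_chart A \<eta> c)" "q' \<in> fst (cover_chart A \<eta> c)"
    and eq: "snd (cover_chart A \<eta> c) q = snd (cover_chart A \<eta> c) q'"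
  have "fst q = chart_inv c (snd c (fst q))" "fst q' = chart_inv c (snd c (fst q'))"
    using q assms by (simp_all add: cover_chart_def chart_inv_chart[OF contact_atlas])
  moreover have "snd c (fst q) = snd c (fst q')" "fibre_coord \<eta> q = fibre_coord \<eta> q'"
    using eq by (simp_all add: cover_chart_def)
  ultimately have "fst q = fst q'" "fibre_coord \<eta> q = fibre_coord \<eta> q'" by simp_all
  moreover have "q \<in> symplectic_cover A \<eta>" "q' \<in> symplectic_cover A \<eta>"
    using q by (simp_all add: cover_chart_def)
  ultimately show "q = q'"
    using cover_point_eq[of q] cover_point_eq[of q'] by simp
qed

lemma chart_inv_cover_chart:
  assumes "c \<in> A" "p \<in> fst c" "s \<noteq> 0"
  shows "chart_inv (cover_chart A \<eta> c) (snd c p, s) = (p, \<lambda>v. s * \<eta> p v)"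
proof -
  have p: "p \<in> points A" using assms by (auto simp: points_def)
  let ?q = "(p, \<lambda>v. s * \<eta> p v)"
  have "?q \<in> fst (cover_chart A \<eta> c)" "snd (cover_chart A \<eta> c) ?q = (snd c p, s)"
    using assms p by (auto simp: cover_chart_def fibre_coord_scaled scaled_mem_cover)
  then show ?thesis
    using inv_into_f_f[OF inj_on_cover_chart[OF assms(1)], of ?q] by (simp add: chart_inv_def)
qed

text \<open>The fibre coordinate refers to \<eta> and not to a chart, so only the base coordinates
  change.\<close>

lemma cover_transition:
  assumes "c \<in> A" "d \<in> A" "z \<in> (snd c ` (fst c \<inter> fst d)) \<times> (- {0})"
  shows "(snd (cover_chart A \<eta> d) \<circ> chart_inv (cover_chart A \<eta> c)) z =
    ((snd d \<circ> chart_inv c) (fst z), snd z)"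
proof -
  obtain p where p: "p \<in> fst c" "p \<in> fst d" "z = (snd c p, snd z)" "snd z \<noteq> 0"
    using assms(3) by (cases z) auto
  moreover have "p \<in> points A" using assms p by (auto simp: points_def)
  moreover have "chart_inv (cover_chart A \<eta> c) z = (p, \<lambda>v. snd z * \<eta> p v)"
    by (subst p(3)) (rule chart_inv_cover_chart[OF assms(1) p(1,4)])
  moreover have "fst z = snd c p" using p(3) by (metis fst_conv)
  ultimately show ?thesis
    using assms(1) by (simp add: cover_chart_def fibre_coord_scaled chart_inv_chart[OF contact_atlas])
qed

lemma open_cover_overlap:
  assumes "c \<in> A" "d \<in> A"
  shows "open ((snd c ` (fst c \<inter> fst d)) \<times> (- {0 :: real}))"
  using open_overlap[OF contact_atlas assms] by (intro open_Times) auto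

lemma smooth_atlas_cover: "smooth_atlas (cover_atlas A \<eta>)"
proof -
  have "smooth_on ((snd c ` (fst c \<inter> fst d)) \<times> (- {0}))
      (snd (cover_chart A \<eta> d) \<circ> chart_inv (cover_chart A \<eta> c))" if cd: "c \<in> A" "d \<in> A" for c d
  proof -
    have "smooth_on ((snd c ` (fst c \<inter> fst d)) \<times> (- {0}))
        (\<lambda>z. ((snd d \<circ> chart_inv c) (fst z), snd z :: real))"
      \<comment> \<open>The instances \<open>0 1 0\<close> are the puncture, the slope and the
        offset: the fibre map is the identity.\<close>
      using smooth_on_map_prod_affine[OF open_overlap[OF contact_atlas cd] open_Compl[OF closed_singleton]
          smooth_transition[OF contact_atlas cd], of 0 1 0] by simp
    then show ?thesis
      by (subst smooth_on_cong[OF open_cover_overlap[OF cd] cover_transition[OF cd]]) simp_all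
  qed
  moreover have "open (snd (cover_chart A \<eta> c) ` fst (cover_chart A \<eta> c))" if "c \<in> A" for c
    using open_cover_overlap[OF that that] by (simp add: cover_chart_image[OF that])
  ultimately show ?thesis
    unfolding smooth_atlas_def cover_atlas_eq
    by (simp add: cover_chart_overlap inj_on_cover_chart open_cover_overlap)
qed

lemma mem_cover_chart:
  "q \<in> symplectic_cover A \<eta> \<Longrightarrow> fst q \<in> fst c \<Longrightarrow> q \<in> fst (cover_chart A \<eta> c)"
  by (simp add: cover_chart_def)

lemma cover_coords_mem_overlap:
  assumes "q \<in> symplectic_cover A \<eta>" "fst q \<in> fst c" "fst q \<in> fst d"
  shows "snd (cover_chart A \<eta> c) q \<in> (snd c ` (fst c \<inter> fst d)) \<times> (- {0})"
  using assms by (simp add: cover_chart_def fibre_coord_nonzero)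

section \<open>Tangent vectors and the canonical form in cover coordinates\<close>

lemma jacobian_cover_chart:
  assumes "c \<in> A" "d \<in> A" "q \<in> symplectic_cover A \<eta>" "fst q \<in> fst c" "fst q \<in> fst d"
  shows "jacobian (cover_chart A \<eta> c) (cover_chart A \<eta> d) q u = (jacobian c d (fst q) (fst u), snd u)"
proof -
  let ?z = "snd (cover_chart A \<eta> c) q"
  have z: "fst ?z = snd c (fst q)" by (simp add: cover_chart_def)
  have "((snd d \<circ> chart_inv c) \<circ> fst has_derivative jacobian c d (fst q) \<circ> fst) (at ?z)"
    by (intro diff_chain_at has_derivative_fst has_derivative_ident, unfold z)
      (intro transition_has_derivative[OF contact_atlas] assms)
  then have "((\<lambda>z. ((snd d \<circ> chart_inv c) (fst z), snd z)) has_derivative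
      (\<lambda>u. (jacobian c d (fst q) (fst u), snd u))) (at ?z)"
    by (auto intro!: has_derivative_Pair has_derivative_snd simp: o_def)
  then have "((snd (cover_chart A \<eta> d) \<circ> chart_inv (cover_chart A \<eta> c)) has_derivative
      (\<lambda>u. (jacobian c d (fst q) (fst u), snd u))) (at ?z)"
    by (rule has_derivative_transform_within_open[OF _ open_cover_overlap[OF assms(1,2)]
          cover_coords_mem_overlap[OF assms(3-5)]]) (rule cover_transition[OF assms(1,2), symmetric])
  from frechet_derivative_at[OF this] show ?thesis by metis
qed

lemma chart_at_cover:
  assumes "q \<in> symplectic_cover A \<eta>"
  obtains c where "c \<in> A" "fst q \<in> fst c" "chart_at (cover_atlas A \<eta>) q = cover_chart A \<eta> c"
proof -
  have "q \<in> points (cover_atlas A \<eta>)" using assms by (simp add: points_cover_atlas)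
  from chart_at_mem[OF this] obtain c where
    "c \<in> A" "chart_at (cover_atlas A \<eta>) q = cover_chart A \<eta> c" "q \<in> fst (cover_chart A \<eta> c)"
    by (auto simp: cover_atlas_eq)
  then show thesis using that by (simp add: cover_chart_def)
qed

lemma cover_tangent_transition:
  assumes "c \<in> A" "d \<in> A" "q \<in> symplectic_cover A \<eta>" "fst q \<in> fst c" "fst q \<in> fst d"
    and "X \<in> tangent_space (cover_atlas A \<eta>) q"
  shows "X (cover_chart A \<eta> d) =
    (jacobian c d (fst q) (fst (X (cover_chart A \<eta> c))), snd (X (cover_chart A \<eta> c)))"
  using tangent_space_transition[OF smooth_atlas_cover assms(6), of "cover_chart A \<eta> c" "cover_chart A \<eta> d"]
    assms jacobian_cover_chart[OF assms(1-5)]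
  by (simp add: cover_atlas_eq mem_cover_chart)

text \<open>\<open>pushforward\<close> is computed in arbitrarily chosen charts, \<open>e\<close> on
  the cover and \<open>d\<close> on the base. The projection drops the fibre component, and the
  chain rule for jacobians removes both choices.\<close>

lemma pushforward_fst_cover:
  assumes "c \<in> A" "q \<in> symplectic_cover A \<eta>" "fst q \<in> fst c"
    and X: "X \<in> tangent_space (cover_atlas A \<eta>) q"
  shows "pushforward (cover_atlas A \<eta>) A fst q X =
    tangent_of A (fst q) c (fst (X (cover_chart A \<eta> c)))"
proof -
  obtain e where e: "e \<in> A" "fst q \<in> fst e" "chart_at (cover_atlas A \<eta>) q = cover_chart A \<eta> e"
    using chart_at_cover assms(2) by blast
  define d where "d = chart_at A (fst q)"
  have "fst q \<in> points A" using assms by (auto simp: points_def)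
  from chart_at_mem[OF this] have d: "d \<in> A" "fst q \<in> fst d" by (simp_all add: d_def)
  let ?z = "snd (cover_chart A \<eta> e) q"
  have z: "fst ?z = snd e (fst q)" by (simp add: cover_chart_def)
  have "((snd d \<circ> chart_inv e) \<circ> fst has_derivative jacobian e d (fst q) \<circ> fst) (at ?z)"
    by (intro diff_chain_at has_derivative_fst has_derivative_ident, unfold z)
      (intro transition_has_derivative[OF contact_atlas] e d)
  then have "(snd d \<circ> fst \<circ> chart_inv (cover_chart A \<eta> e) has_derivative
      jacobian e d (fst q) \<circ> fst) (at ?z)"
  proof (rule has_derivative_transform_within_open[OF _ open_cover_overlap[OF e(1) d(1)]
          cover_coords_mem_overlap[OF assms(2) e(2) d(2)]])
    fix z assume "z \<in> (snd e ` (fst e \<inter> fst d)) \<times> (- {0 :: real})"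
    then obtain p s where "p \<in> fst e" "z = (snd e p, s)" "s \<noteq> 0" by auto
    then show "((snd d \<circ> chart_inv e) \<circ> fst) z = (snd d \<circ> fst \<circ> chart_inv (cover_chart A \<eta> e)) z"
      using e by (simp add: chart_inv_cover_chart chart_inv_chart[OF contact_atlas])
  qed
  from frechet_derivative_at[OF this, symmetric]
  have "pushforward (cover_atlas A \<eta>) A fst q X =
      tangent_of A (fst q) d (jacobian e d (fst q) (fst (X (cover_chart A \<eta> e))))"
    by (simp add: pushforward_def Let_def e(3) flip: d_def)
  then show ?thesis
    using tangent_of_change_chart[OF contact_atlas e(1) d(1) e(2) d(2)]
      tangent_of_change_chart[OF contact_atlas assms(1) e(1) assms(3) e(2)]
      cover_tangent_transition[OF assms(1) e(1) assms(2,3) e(2) X] by simp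
qed

text \<open>The covector at \<open>q\<close> is \<eta> scaled by the fibre coordinate
  \<open>t\<close>, and the projection forgets the fibre component of \<open>X\<close>; this is
  \<open>\<omega> = t \<eta>\<close>.\<close>

lemma canonical_form_coord:
  assumes "c \<in> A" "q \<in> symplectic_cover A \<eta>" "fst q \<in> fst c"
    and X: "X \<in> tangent_space (cover_atlas A \<eta>) q"
  shows "canonical_form A \<eta> q X =
    fibre_coord \<eta> q * form_coord A \<eta> c (snd c (fst q)) (fst (X (cover_chart A \<eta> c)))"
proof -
  have "snd q v = fibre_coord \<eta> q * \<eta> (fst q) v" for v
    using arg_cong[OF cover_point_eq[OF assms(2)], of "\<lambda>q. snd q v"] by simp
  then show ?thesis
    using assms by (simp add: canonical_form_def pushforward_fst_cover form_coord_def
        chart_inv_chart[OF contact_atlas])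
qed

lemma form_coord_canonical_form:
  assumes "c \<in> A" "z \<in> (snd c ` fst c) \<times> (- {0})"
  shows "form_coord (cover_atlas A \<eta>) (canonical_form A \<eta>) (cover_chart A \<eta> c) z u =
    snd z * form_coord A \<eta> c (fst z) (fst u)"
proof -
  obtain p where p: "p \<in> fst c" "z = (snd c p, snd z)" "snd z \<noteq> 0"
    using assms(2) by (cases z) auto
  let ?q = "(p, \<lambda>v. snd z * \<eta> p v)"
  have pA: "p \<in> points A" using assms p by (auto simp: points_def)
  have q: "?q \<in> symplectic_cover A \<eta>" using pA p by (simp add: scaled_mem_cover)
  have C: "cover_chart A \<eta> c \<in> cover_atlas A \<eta>" "?q \<in> fst (cover_chart A \<eta> c)"
    using assms p q by (auto simp: cover_atlas_eq mem_cover_chart)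
  have "chart_inv (cover_chart A \<eta> c) z = ?q"
    by (subst p(2)) (rule chart_inv_cover_chart[OF assms(1) p(1,3)])
  moreover have "fst z = snd c p" using p(2) by (metis fst_conv)
  ultimately show ?thesis
    using canonical_form_coord[OF assms(1) q _ tangent_of_mem[OF smooth_atlas_cover C]]
      p pA by (simp add: form_coord_def[of "cover_atlas A \<eta>"] fibre_coord_scaled
        tangent_of_self[OF smooth_atlas_cover C])
qed

text \<open>The coordinate form of \<open>d(t \<eta>) = dt \<and> \<eta> + t d\<eta>\<close>.\<close>

lemma ext_deriv_coord_canonical_form:
  assumes "c \<in> A" "z \<in> (snd c ` fst c) \<times> (- {0})"
  shows "ext_deriv_coord (cover_atlas A \<eta>) (canonical_form A \<eta>) (cover_chart A \<eta> c) z v w =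
    snd v * form_coord A \<eta> c (fst z) (fst w) - snd w * form_coord A \<eta> c (fst z) (fst v) +
    snd z * ext_deriv_coord A \<eta> c (fst z) (fst v) (fst w)"
proof -
  let ?D = "\<lambda>u. frechet_derivative (\<lambda>x. form_coord A \<eta> c x u) (at (fst z))"
  \<comment> \<open>Product rule for \<open>t\<close> times a component of \<eta>: after
    antisymmetrization the first summand gives \<open>t d\<eta>\<close> and the second
    \<open>dt \<and> \<eta>\<close>.\<close>
  have "frechet_derivative (\<lambda>z. form_coord (cover_atlas A \<eta>) (canonical_form A \<eta>) (cover_chart A \<eta> c) z w)
      (at z) v = snd z * ?D (fst w) (fst v) + snd v * form_coord A \<eta> c (fst z) (fst w)" for v w
  proof -
    have "((\<lambda>x. form_coord A \<eta> c x (fst w)) has_derivative ?D (fst w)) (at (fst z))"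
      using form_coord_has_derivative[OF contact_atlas contact_one_form assms(1)] assms(2) by auto
    from has_derivative_compose[OF has_derivative_fst[OF has_derivative_ident] this]
    have "((\<lambda>z. snd z * form_coord A \<eta> c (fst z) (fst w)) has_derivative
        (\<lambda>v. snd z * ?D (fst w) (fst v) + snd v * form_coord A \<eta> c (fst z) (fst w))) (at z)"
      by (intro has_derivative_mult has_derivative_snd[OF has_derivative_ident])
    then have "((\<lambda>z. form_coord (cover_atlas A \<eta>) (canonical_form A \<eta>) (cover_chart A \<eta> c) z w)
        has_derivative (\<lambda>v. snd z * ?D (fst w) (fst v) + snd v * form_coord A \<eta> c (fst z) (fst w))) (at z)"
    proof (rule has_derivative_transform_within_open)
      show "open ((snd c ` fst c) \<times> (- {0::real}))"
        using open_cover_overlap[OF assms(1,1)] by simp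
    qed (use assms in \<open>simp_all add: form_coord_canonical_form\<close>)
    from frechet_derivative_at[OF this, symmetric] show ?thesis by simp
  qed
  then show ?thesis by (simp add: ext_deriv_coord_def algebra_simps)
qed

text \<open>
  As the dimension is odd, \<open>d\<eta>\<close> has a kernel vector \<open>r\<close>, on which \<open>\<eta>\<close> cannot vanish;
  testing against \<open>r\<close> shows that \<open>v\<close> has no vertical component.
\<close>

lemma cover_symplectic_form_nondegenerate:
  assumes c: "c \<in> A" "p \<in> fst c" and s: "s \<noteq> 0"
    and v: "\<And>w. ext_deriv_coord (cover_atlas A \<eta>) (canonical_form A \<eta>) (cover_chart A \<eta> c)
      (snd c p, s) v w = 0"
  shows "v = 0"
proof -
  let ?a = "form_coord A \<eta> c (snd c p)" and ?B = "ext_deriv_coord A \<eta> c (snd c p)"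
  have v': "snd v * ?a w1 - w2 * ?a (fst v) + s * ?B (fst v) w1 = 0" for w1 w2
    using v[of "(w1, w2)"] ext_deriv_coord_canonical_form[OF c(1), of "(snd c p, s)" v "(w1, w2)"] c s
    by simp
  have B: "bilinear ?B"
    using ext_deriv_coord_bilinear[OF contact_atlas contact_one_form c(1)] c by blast
  have skew: "?B x y = - ?B y x" for x y by (simp add: ext_deriv_coord_def)
  have a: "linear ?a"
    using form_coord_linear[OF contact_atlas contact_one_form c(1)] c by blast
  have p: "p \<in> points A" using c by (auto simp: points_def)
  have "odd DIM('e)" using contact by (simp add: cooriented_contact_def)
  moreover have "?B x x = 0" for x by (simp add: ext_deriv_coord_def)
  ultimately obtain r where r: "r \<noteq> 0" "\<And>y. ?B r y = 0"
    using alternating_odd_radical[OF B] by blast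
  \<comment> \<open>The contact condition in coordinates: the kernels of \<eta> and
    \<open>d\<eta>\<close> meet only in zero.\<close>
  have kernel: "x = 0" if "?a x = 0" "\<And>y. ?B x y = 0" for x
  proof -
    let ?X = "tangent_of A p c x"
    have X: "?X \<in> tangent_space A p" by (rule tangent_of_mem[OF contact_atlas c])
    moreover have "\<eta> p ?X = 0"
      using that(1) c by (simp add: form_coord_def chart_inv_chart[OF contact_atlas])
    moreover have "ext_deriv A \<eta> p ?X w = 0" if "w \<in> tangent_space A p" for w
      using ext_deriv_eq_coord[OF contact_atlas contact_one_form c X that] \<open>\<And>y. ?B x y = 0\<close>
      by (simp add: tangent_of_self[OF contact_atlas c])
    ultimately have "?X \<in> {\<lambda>_. 0}"
      using contact p unfolding cooriented_contact_def by blast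
    then show ?thesis
      using tangent_of_self[OF contact_atlas c, of x] by simp
  qed
  have "?a r \<noteq> 0" using kernel r by blast
  have "?B (fst v) r = 0" using r(2) skew[of "fst v" r] by simp
  then have "snd v = 0" using v'[of r 0] \<open>?a r \<noteq> 0\<close> by simp
  \<comment> \<open>The fibre direction \<open>(0, 1)\<close> isolates \<open>\<eta>(fst v)\<close>;
    as \<open>snd v = 0\<close>, the base directions \<open>(y, 0)\<close> isolate
    \<open>s d\<eta>(fst v, y)\<close>.\<close>
  moreover have "?B (fst v) 0 = 0" using bilinear_rzero[OF B] .
  then have "?a (fst v) = 0" using v'[of 0 1] linear_0[OF a] by simp
  then have "?B (fst v) y = 0" for y using v'[of y 0] \<open>snd v = 0\<close> s by simp
  then have "fst v = 0" using kernel \<open>?a (fst v) = 0\<close> by blast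
  ultimately show ?thesis by (simp add: prod_eq_iff)
qed

section \<open>The Liouville field and its flow\<close>

lemma liouville_field_coord:
  assumes E: "liouville_field A \<eta> E" and q: "q \<in> symplectic_cover A \<eta>"
    and d: "d \<in> A" "fst q \<in> fst d"
  shows "E q (cover_chart A \<eta> d) = (0, fibre_coord \<eta> q)"
proof -
  obtain c where c: "c \<in> A" "fst q \<in> fst c" "chart_at (cover_atlas A \<eta>) q = cover_chart A \<eta> c"
    using chart_at_cover q by blast
  let ?C = "cover_chart A \<eta> c" and ?s = "fibre_coord \<eta> q"
  let ?B = "ext_deriv_coord (cover_atlas A \<eta>) (canonical_form A \<eta>) ?C (snd ?C q)"
  let ?a = "form_coord A \<eta> c (snd c (fst q))" and ?b = "ext_deriv_coord A \<eta> c (snd c (fst q))"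
  have C: "?C \<in> cover_atlas A \<eta>" "q \<in> fst ?C"
    using c q by (auto simp: cover_atlas_eq mem_cover_chart)
  have s: "?s \<noteq> 0" by (rule fibre_coord_nonzero[OF q])
  have z: "snd ?C q = (snd c (fst q), ?s)" by (simp add: cover_chart_def)
  have EqT: "E q \<in> tangent_space (cover_atlas A \<eta>) q"
    using E q unfolding liouville_field_def vector_field_def points_cover_atlas by blast
  have B: "?B v w = snd v * ?a (fst w) - snd w * ?a (fst v) + ?s * ?b (fst v) (fst w)" for v w
    using ext_deriv_coord_canonical_form[OF c(1), of "snd ?C q" v w] c s by (simp add: z)
  have b: "bilinear ?b"
    using ext_deriv_coord_bilinear[OF contact_atlas contact_one_form c(1)] c by blast
  have a: "linear ?a"
    using form_coord_linear[OF contact_atlas contact_one_form c(1)] c by blast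
  \<comment> \<open>Every coordinate vector \<open>w\<close> comes from a tangent vector, so the
    defining equation of \<open>E\<close> can be tested on all of them.\<close>
  have "?B (E q ?C) w = ?s * ?a (fst w)" for w
  proof -
    let ?X = "tangent_of (cover_atlas A \<eta>) q ?C w"
    have X: "?X \<in> tangent_space (cover_atlas A \<eta>) q" by (rule tangent_of_mem[OF smooth_atlas_cover C])
    then have "cover_symplectic_form A \<eta> q (E q) ?X = canonical_form A \<eta> q ?X"
      using E q unfolding liouville_field_def by blast
    then show ?thesis
      by (simp add: cover_symplectic_form_def ext_deriv_eq_coord_chart_at c(3)
          tangent_of_self[OF smooth_atlas_cover C] canonical_form_coord[OF c(1) q c(2) X])
  qed
  \<comment> \<open>The vector \<open>(0, ?s)\<close> solves the same equation, so its difference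
    from \<open>E\<close> lies in the radical of the form, which is zero.\<close>
  then have "?B (E q ?C - (0, ?s)) w = 0" for w
    using linear_0[OF a] bilinear_lzero[OF b]
    by (simp add: B linear_diff[OF a] bilinear_lsub[OF b] algebra_simps)
  then have "E q ?C - (0, ?s) = 0"
    unfolding z using cover_symplectic_form_nondegenerate[OF c(1,2) s] by blast
  then have "E q ?C = (0, ?s)" by simp
  \<comment> \<open>The change from \<open>c\<close> to \<open>d\<close> is linear on the base
    component, preserving its value 0, and is the identity on the fibre component.\<close>
  moreover have "linear (jacobian c d (fst q))"
    using transition_has_derivative[OF contact_atlas c(1) d(1) c(2) d(2)] has_derivative_linear by blast
  ultimately show ?thesis
    using cover_tangent_transition[OF c(1) d(1) q c(2) d(2) EqT] by (simp add: linear_0)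
qed

text \<open>The flow of \<open>t \<partial>/\<partial>t\<close> multiplies covectors by
  \<open>exp s\<close>; its flow lines exist for all times and each stays in one fibre.\<close>

lemma liouville_integral_curve:
  assumes E: "liouville_field A \<eta> E" and p: "p \<in> points A" and t: "t \<noteq> 0"
  shows "integral_curve (cover_atlas A \<eta>) E UNIV (\<lambda>s. (p, \<lambda>v. (t * exp s) * \<eta> p v))"
proof -
  let ?\<gamma> = "\<lambda>s::real. (p, \<lambda>v. (t * exp s) * \<eta> p v)"
  have mem: "?\<gamma> s \<in> symplectic_cover A \<eta>" for s
    using p t by (intro scaled_mem_cover) auto
  have fib: "fibre_coord \<eta> (?\<gamma> s) = t * exp s" for s
    by (rule fibre_coord_scaled[OF p])
  have coord: "snd (cover_chart A \<eta> c) \<circ> ?\<gamma> = (\<lambda>s. (snd c p, t * exp s))" for c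
    by (simp add: cover_chart_def fib o_def)
  have "continuous_map euclidean (manifold_topology (cover_atlas A \<eta>)) ?\<gamma>"
    unfolding manifold_topology_def
  proof (rule continuous_on_generated_topo)
    fix U assume "U \<in> {{p \<in> fst c. snd c p \<in> W} |c W. c \<in> cover_atlas A \<eta> \<and> open W}"
    then obtain C W where C: "C \<in> cover_atlas A \<eta>" "U = {q \<in> fst C. snd C q \<in> W}" "open W"
      by blast
    then obtain c where c: "U = {q \<in> fst (cover_chart A \<eta> c). snd (cover_chart A \<eta> c) q \<in> W}" "open W"
      unfolding cover_atlas_eq by blast
    \<comment> \<open>The base point never moves, so the preimage is either empty or that of
      \<open>W\<close> under the coordinate curve.\<close>
    have "?\<gamma> -` U = (if p \<in> fst c then (\<lambda>s. (snd c p, t * exp s)) -` W else {})"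
      using mem by (auto simp: c cover_chart_def fib)
    moreover have "open ((\<lambda>s. (snd c p, t * exp s)) -` W)"
      by (intro open_vimage c continuous_intros)
    ultimately show "openin euclidean (?\<gamma> -` U \<inter> topspace euclidean)" by simp
  next
    have "?\<gamma> ` UNIV \<subseteq> topspace (manifold_topology (cover_atlas A \<eta>))"
      unfolding topspace_manifold_topology points_cover_atlas using mem by (rule image_subsetI)
    then show "?\<gamma> ` topspace euclidean \<subseteq>
        \<Union> {{p \<in> fst c. snd c p \<in> W} |c W. c \<in> cover_atlas A \<eta> \<and> open W}"
      unfolding manifold_topology_def topology_generated_by_topspace topspace_euclidean .
  qed
  then have "smooth_curve (cover_atlas A \<eta>) UNIV ?\<gamma>"
    unfolding smooth_curve_def cover_atlas_eq by (auto simp: coord smooth_on_exp_curve)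
  moreover have "velocity (cover_atlas A \<eta>) ?\<gamma> s = E (?\<gamma> s)" for s
  proof
    fix C
    have ET: "E (?\<gamma> s) \<in> tangent_space (cover_atlas A \<eta>) (?\<gamma> s)"
      using E mem unfolding liouville_field_def vector_field_def points_cover_atlas by blast
    show "velocity (cover_atlas A \<eta>) ?\<gamma> s C = E (?\<gamma> s) C"
    proof (cases "C \<in> cover_atlas A \<eta> \<and> ?\<gamma> s \<in> fst C")
      case True
      then obtain c where c: "c \<in> A" "C = cover_chart A \<eta> c" "p \<in> fst c"
        by (auto simp: cover_atlas_eq cover_chart_def)
      have "((\<lambda>s. (snd c p, t * exp s)) has_vector_derivative (0, t * exp s)) (at s)"
        by (auto intro!: derivative_eq_intros has_vector_derivative_Pair
            simp flip: has_real_derivative_iff_has_vector_derivative)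
      then have "vector_derivative (snd C \<circ> ?\<gamma>) (at s) = (0, t * exp s)"
        unfolding c(2) coord by (rule vector_derivative_at)
      then show ?thesis
        using True liouville_field_coord[OF E mem, of c s] c by (simp add: velocity_def fib)
    next
      \<comment> \<open>By convention, tangent vectors and velocities are both zero at indices that
        are not charts around the point.\<close>
      case False
      then have "E (?\<gamma> s) C = 0" using ET unfolding tangent_space_def by blast
      then show ?thesis using False unfolding velocity_def by (simp only: if_False)
    qed
  qed
  ultimately show ?thesis by (simp add: integral_curve_def)
qed

text \<open>Invariance keeps the flow line through \<open>q\<close> inside \<open>L\<close>, and its
  velocity at time 0 is \<open>E q\<close>.\<close>

lemma liouville_tangent:
  assumes E: "liouville_field A \<eta> E" and L: "flow_invariant (cover_atlas A \<eta>) E L"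
    and q: "q \<in> L" "q \<in> symplectic_cover A \<eta>"
  shows "E q \<in> submanifold_tangent (cover_atlas A \<eta>) L q"
proof -
  define \<gamma> where "\<gamma> = (\<lambda>s. (fst q, \<lambda>v. (fibre_coord \<eta> q * exp s) * \<eta> (fst q) v))"
  have \<gamma>: "integral_curve (cover_atlas A \<eta>) E UNIV \<gamma>" "\<gamma> 0 = q"
    unfolding \<gamma>_def
    by (rule liouville_integral_curve[OF E fst_cover_mem[OF q(2)] fibre_coord_nonzero[OF q(2)]])
      (simp flip: cover_point_eq[OF q(2)])
  then have "\<gamma> ` UNIV \<subseteq> L" using L q unfolding flow_invariant_def by blast
  moreover have "smooth_curve (cover_atlas A \<eta>) UNIV \<gamma>" "velocity (cover_atlas A \<eta>) \<gamma> 0 = E q"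
    using \<gamma> by (simp_all add: integral_curve_def)
  ultimately show ?thesis
    unfolding submanifold_tangent_def using \<gamma>(2)
    by (intro CollectI exI[of _ \<gamma>] exI[of _ UNIV]) simp
qed

end

section \<open>The Hamiltonian, the canonical form and tangency along \<open>L\<close>\<close>

theorem theorem4p3:
  fixes n :: nat
    and Mc :: "('m, 'e::euclidean_space) chart set"
    and \<eta> :: "'m \<Rightarrow> ('m, 'e) covector"
    and E Z :: "'m \<times> ('m, 'e) covector \<Rightarrow> ('m \<times> ('m, 'e) covector, 'e \<times> real) tangent"
    and H :: "'m \<times> ('m, 'e) covector \<Rightarrow> real"
    and L :: "('m \<times> ('m, 'e) covector) set"
  defines "Ms \<equiv> cover_atlas Mc \<eta>"
    and "\<omega> \<equiv> canonical_form Mc \<eta>"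
    and "\<Omega> \<equiv> cover_symplectic_form Mc \<eta>"
  assumes contact: "cooriented_contact n Mc \<eta>"
    and liouville: "liouville_field Mc \<eta> E"
    and H_smooth: "smooth_function Ms H"
    and H_homogeneous: "\<forall>q\<in>points Ms. differential Ms H q (E q) = H q"
    and hamiltonian: "hamiltonian_field Mc \<eta> H Z"
    and L_lagrangian: "lagrangian Ms \<Omega> L"
    and L_liouville: "flow_invariant Ms E L"
  shows "(\<forall>C\<in>connected_components_of (manifold_topology Ms).
            (\<lambda>q. H q - (- \<omega> q (Z q))) constant_on C)
       \<and> (\<forall>q\<in>L. \<forall>X\<in>submanifold_tangent Ms L q. \<omega> q X = 0)
       \<and> (tangent_to Ms Z L \<longleftrightarrow>
            (\<forall>C\<in>connected_components_of (manifold_topology Ms). H constant_on (L \<inter> C)))"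
proof -
  have atlas: "smooth_atlas Ms" unfolding Ms_def by (rule smooth_atlas_cover[OF contact])
  have pts: "points Ms = symplectic_cover Mc \<eta>" by (simp add: Ms_def points_cover_atlas)
  have skew: "\<Omega> q X Y = - \<Omega> q Y X" for q X Y
    unfolding \<Omega>_def cover_symplectic_form_def by (rule ext_deriv_skew)
  have ET: "E q \<in> tangent_space Ms q" and ZT: "Z q \<in> tangent_space Ms q" if "q \<in> points Ms" for q
    using liouville hamiltonian that
    unfolding liouville_field_def hamiltonian_field_def vector_field_def Ms_def by blast+
  have \<Omega>E: "\<Omega> q (E q) X = \<omega> q X" and \<Omega>Z: "\<Omega> q (Z q) X = differential Ms H q X"
    if "q \<in> points Ms" "X \<in> tangent_space Ms q" for q X
    using liouville hamiltonian that
    unfolding liouville_field_def hamiltonian_field_def pts unfolding Ms_def \<Omega>_def \<omega>_def by blast+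
  have H: "H q = - \<omega> q (Z q)" if q: "q \<in> points Ms" for q
  proof -
    have "H q = \<Omega> q (Z q) (E q)" using H_homogeneous q \<Omega>Z[OF q ET[OF q]] by simp
    then show ?thesis using skew[of q "Z q" "E q"] \<Omega>E[OF q ZT[OF q]] by simp
  qed
  have Lpts: "L \<subseteq> points Ms"
    using L_lagrangian by (simp add: lagrangian_def submanifold_def)
  have TL: "submanifold_tangent Ms L q =
      {v \<in> tangent_space Ms q. \<forall>w\<in>submanifold_tangent Ms L q. \<Omega> q v w = 0}" if "q \<in> L" for q
    using L_lagrangian that by (simp add: lagrangian_def)
  have vanish: "\<omega> q X = 0" if "q \<in> L" "X \<in> submanifold_tangent Ms L q" for q X
  proof -
    have q: "q \<in> points Ms" using that Lpts by blast
    have "E q \<in> submanifold_tangent Ms L q"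
      using liouville_tangent[OF contact liouville _ \<open>q \<in> L\<close>] L_liouville q
      by (simp add: pts flip: Ms_def)
    \<comment> \<open>The Lagrangian condition in its isotropic direction: vectors tangent to
      \<open>L\<close> pair to zero.\<close>
    then have "\<Omega> q (E q) X = 0" "X \<in> tangent_space Ms q" using TL[OF that(1)] that(2) by blast+
    then show ?thesis using \<Omega>E[OF q] by simp
  qed
  have a: "(\<lambda>q. H q - (- \<omega> q (Z q))) constant_on C"
    if "C \<in> connected_components_of (manifold_topology Ms)" for C
  proof -
    have "H q - (- \<omega> q (Z q)) = 0" if "q \<in> C" for q
      using connected_components_of_subset[OF \<open>C \<in> _\<close>] H[of q] that
      by (auto simp: topspace_manifold_topology)
    then show ?thesis unfolding constant_on_def by blast
  qed
  have "H constant_on (L \<inter> C)" if "tangent_to Ms Z L" for C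
  proof -
    have "H q = 0" if "q \<in> L" for q
      using \<open>tangent_to Ms Z L\<close> vanish[OF that] H[of q] Lpts that unfolding tangent_to_def by auto
    then show ?thesis unfolding constant_on_def by blast
  qed
  moreover have "tangent_to Ms Z L"
    if const: "\<And>C. C \<in> connected_components_of (manifold_topology Ms) \<Longrightarrow> H constant_on (L \<inter> C)"
    unfolding tangent_to_def
  proof
    fix q assume "q \<in> L"
    then have q: "q \<in> points Ms" using Lpts by blast
    have "\<Omega> q (Z q) X = 0" if X: "X \<in> submanifold_tangent Ms L q" for X
    proof -
      obtain \<gamma> J where \<gamma>: "X = velocity Ms \<gamma> 0" "smooth_curve Ms J \<gamma>" "0 \<in> J" "\<gamma> 0 = q" "\<gamma> ` J \<subseteq> L"
        using X unfolding submanifold_tangent_def by blast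
      let ?C = "connected_component_of_set (manifold_topology Ms) q"
      \<comment> \<open>The image of a curve is connected, so a curve in \<open>L\<close> through
        \<open>q\<close> stays in the component of \<open>q\<close>, where \<open>H\<close> is
        constant on \<open>L\<close>.\<close>
      have "connectedin (top_of_set J) J"
        using \<gamma>(2) by (simp add: connectedin_subtopology smooth_curve_def is_interval_connected)
      then have "connectedin (manifold_topology Ms) (\<gamma> ` J)"
        using \<gamma>(2) connectedin_continuous_map_image unfolding smooth_curve_def by blast
      then have "\<gamma> ` J \<subseteq> ?C"
        using \<gamma>(3,4) by (intro connected_component_of_maximal) auto
      moreover have "H constant_on (L \<inter> ?C)"
        using q by (intro const) (simp add: connected_component_in_connected_components_of
            topspace_manifold_topology)
      ultimately have "H constant_on (\<gamma> ` J)"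
        using constant_on_subset[of H "L \<inter> ?C" "\<gamma> ` J"] \<gamma>(5) by simp
      then have "differential Ms H q X = 0"
        using differential_velocity_eq_0[OF atlas H_smooth \<gamma>(2,3)] \<gamma> by simp
      moreover have "X \<in> tangent_space Ms q" using TL[OF \<open>q \<in> L\<close>] X by blast
      ultimately show ?thesis using \<Omega>Z[OF q] by simp
    qed
    \<comment> \<open>The Lagrangian condition in its maximal direction: a tangent vector of the
      cover that is orthogonal to the tangent space of \<open>L\<close> belongs to it.\<close>
    then show "Z q \<in> submanifold_tangent Ms L q" using TL[OF \<open>q \<in> L\<close>] ZT[OF q] by blast
  qed
  ultimately show ?thesis using a vanish by blast
qed

end
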